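(* Let $R$ be a commutative noetherian ring and let $\mathrm{mod}\,R$ be the category of finitely generated $R$-modules. Let $\mathcal{X}$ be a tensor-ideal subcategory of $\mathrm{mod}\,R$ which is closed under direct summands and extensions. Then $\mathcal{X}$ is a Serre subcategory of $\mathrm{mod}\,R$.
   Context: All subcategories are strictly full (full and closed under isomorphism). A subcategory $\mathcal{X}$ of $\mathrm{mod}\,R$ is: tensor-ideal if $M\otimes_R X\in\mathcal{X}$ for all $M\in\mathrm{mod}\,R$ and $X\in\mathcal{X}$; closed under direct summands if every direct summand of a module in $\mathcal{X}$ is in $\mathcal{X}$; closed under extensions if for each exact sequence $0\to L\to M\to N\to0$ in $\mathrm{mod}\,R$ with $L,N\in\mathcal{X}$ one has $M\in\mathcal{X}$; Serre if it is closed under submodules, quotient modules and extensions. *)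

theory Defs
  imports "HOL-Algebra.Ring_Divisibility" "Jordan_Normal_Form.Missing_VectorSpace"
begin

text \<open>
  Linear combinations, spans (\<open>module.span\<close>), submodules (\<open>submodule R N M\<close>), module
  homomorphisms (\<open>module_hom R M N\<close>), binary direct sums (\<open>direct_sum\<close>) and the module of all
  functions from a set to the ring (\<open>ring.func_space\<close>) are those of the AFP entry VectorSpace,
  which works over arbitrary commutative rings.
\<close>

definition module_iso ::
    "('a, 'r) ring_scheme \<Rightarrow> ('a, 'b, 'm) module_scheme \<Rightarrow> ('a, 'c, 'n) module_scheme \<Rightarrow> bool"
  where "module_iso R M N \<longleftrightarrow> (\<exists>f \<in> module_hom R M N. bij_betw f (carrier M) (carrier N))"


section \<open>The category of finitely generated modules\<close>

definition fg_module :: "('a, 'r) ring_scheme \<Rightarrow> ('a, 'b, 'm) module_scheme \<Rightarrow> bool"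
  where "fg_module R M \<longleftrightarrow>
    module R M \<and> (\<exists>A. finite A \<and> A \<subseteq> carrier M \<and> module.span R M A = carrier M)"

text \<open>
  The objects of \<open>mod R\<close> whose underlying set lives in the type \<open>'b\<close>.
\<close>

definition mod_cat :: "('a, 'r) ring_scheme \<Rightarrow> ('a, 'b) module set"
  where "mod_cat R = {M. fg_module R M}"

text \<open>
  A HOL type \<open>'b\<close> plays the role of the universe. The condition below is a cardinality bound
  ensuring that \<open>mod_cat R\<close>, taken at the type \<open>'b\<close>, is equivalent to the category of all finitely
  generated \<open>R\<close>-modules: every finitely generated \<open>R\<close>-module, on any type, is isomorphic to
  one on \<open>'b\<close> (lemma \<open>mod_universe_fg\<close> below). It holds for instance when \<open>'b\<close> is the type of
  lists over the ring (lemma \<open>mod_universe_list\<close>).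
\<close>

definition mod_universe :: "('a, 'r) ring_scheme \<Rightarrow> 'b itself \<Rightarrow> bool"
  where "mod_universe R U \<longleftrightarrow> infinite (UNIV :: 'b set) \<and> (\<exists>\<iota> :: 'a \<Rightarrow> 'b. inj_on \<iota> (carrier R))"

lemma mod_universe_list: "mod_universe R TYPE('a list)" for R :: "('a, 'r) ring_scheme"
  unfolding mod_universe_def
  using infinite_UNIV_listI by (auto intro!: exI[of _ "\<lambda>a. [a]"] inj_onI)

lemma PiE_inj_infinite:
  assumes "infinite (UNIV :: 'b set)" and "inj_on (\<iota> :: 'a \<Rightarrow> 'b) A" and "finite S"
  shows "\<exists>j :: ('s \<Rightarrow> 'a) \<Rightarrow> 'b. inj_on j (S \<rightarrow>\<^sub>E A)"
  using assms(3)
proof induction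
  case empty
  show ?case by (auto intro!: exI inj_onI)
next
  case (insert s S)
  then obtain j :: "('s \<Rightarrow> 'a) \<Rightarrow> 'b" where j: "inj_on j (S \<rightarrow>\<^sub>E A)" by auto
  have "(card_of ((UNIV :: 'b set) \<times> (UNIV :: 'b set)), card_of (UNIV :: 'b set)) \<in> ordLeq"
    by (rule ordIso_imp_ordLeq) (rule card_of_Times_same_infinite[OF assms(1)])
  from iffD2[OF card_of_ordLeq this] obtain p :: "'b \<times> 'b \<Rightarrow> 'b" where p: "inj_on p (UNIV \<times> UNIV)"
    by (elim exE conjE)
  define k where "k f = p (\<iota> (f s), j (restrict f S))" for f
  have "inj_on k (insert s S \<rightarrow>\<^sub>E A)"
  proof (rule inj_onI)
    fix f g assume f: "f \<in> insert s S \<rightarrow>\<^sub>E A" and g: "g \<in> insert s S \<rightarrow>\<^sub>E A" and "k f = k g"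
    then have "\<iota> (f s) = \<iota> (g s)" and 2: "j (restrict f S) = j (restrict g S)"
      using inj_onD[OF p, of "(\<iota> (f s), j (restrict f S))" "(\<iota> (g s), j (restrict g S))"]
      unfolding k_def by simp_all
    then have 1: "f s = g s" using f g by (intro inj_onD[OF assms(2)]) auto
    have "restrict f S = restrict g S"
      using 2 f g by (intro inj_onD[OF j]) auto
    then have "f t = g t" if "t \<in> S" for t by (metis restrict_apply that)
    with 1 show "f = g" by (intro PiE_ext[OF f g]) blast
  qed
  then show ?case by blast
qed

lemma mod_universe_fg:
  fixes R :: "('a, 'r) ring_scheme" and M :: "('a, 'c, 'm) module_scheme"
  assumes "mod_universe R TYPE('b)" and "fg_module R M"
  shows "\<exists>N :: ('a, 'b) module. N \<in> mod_cat R \<and> module_iso R M N"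
proof -
  from assms(2) interpret M: module R M by (simp add: fg_module_def)
  obtain A where A: "finite A" "A \<subseteq> carrier M" "M.span A = carrier M"
    using assms(2) by (auto simp: fg_module_def)
  obtain \<iota> :: "'a \<Rightarrow> 'b" where "infinite (UNIV :: 'b set)" "inj_on \<iota> (carrier R)"
    using assms(1) by (auto simp: mod_universe_def)
  then obtain j :: "('c \<Rightarrow> 'a) \<Rightarrow> 'b" where j: "inj_on j (A \<rightarrow>\<^sub>E carrier R)"
    using PiE_inj_infinite[OF _ _ A(1)] by blast
  have "\<exists>c. c \<in> A \<rightarrow>\<^sub>E carrier R \<and> M.lincomb c A = x" if x: "x \<in> carrier M" for x
  proof -
    obtain c where "c \<in> A \<rightarrow> carrier R" "M.lincomb c A = x"
      using x unfolding A(3)[symmetric] M.finite_span[OF A(1,2)] by blast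
    moreover from this have "M.lincomb (restrict c A) A = x"
      unfolding M.lincomb_def using A(2) by (subst M.finsum_cong'[where g = "\<lambda>v. c v \<odot>\<^bsub>M\<^esub> v" and B = A]) auto
    ultimately show ?thesis by (intro exI[of _ "restrict c A"]) auto
  qed
  then obtain c where c: "\<And>x. x \<in> carrier M \<Longrightarrow> c x \<in> A \<rightarrow>\<^sub>E carrier R \<and> M.lincomb (c x) A = x"
    by metis
  define h where "h = j \<circ> c"
  have h: "inj_on h (carrier M)"
    by (rule inj_onI) (metis c comp_apply h_def inj_onD j)
  define g where "g = inv_into (carrier M) h"
  have gh [simp]: "g (h x) = x" if "x \<in> carrier M" for x
    using that h by (simp add: g_def)
  define N :: "('a, 'b) module" where
    "N = \<lparr> carrier = h ` carrier M, mult = (\<lambda>x y. x), one = h \<zero>\<^bsub>M\<^esub>, zero = h \<zero>\<^bsub>M\<^esub>,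
           add = (\<lambda>x y. h (g x \<oplus>\<^bsub>M\<^esub> g y)), smult = (\<lambda>a x. h (a \<odot>\<^bsub>M\<^esub> g x)) \<rparr>"
  have N: "module R N"
    by (rule module_criteria)
       (auto simp: N_def M.smult_assoc1 M.smult_l_distr M.smult_r_distr M.a_ac M.R.is_cring M.r_neg
         intro!: bexI[of _ "\<ominus>\<^bsub>M\<^esub> _"])
  have hom: "h \<in> module_hom R M N"
    by (auto simp: module_hom_def N_def)
  interpret N: module R N by fact
  have carN: "carrier N = h ` carrier M" by (simp add: N_def)
  have hA: "h ` A \<subseteq> carrier N" using A(2) unfolding carN by blast
  interpret hom: mod_hom R M N h by unfold_locales (rule hom)
  have sub: "submodule R (N.span (h ` A)) N" by (rule N.span_is_submodule[OF hA])
  have "submodule R {x \<in> carrier M. h x \<in> N.span (h ` A)} M"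
    using sub unfolding submodule_def by (auto simp: M.module_axioms)
  moreover have "A \<subseteq> {x \<in> carrier M. h x \<in> N.span (h ` A)}"
    using A(2) N.in_own_span[OF hA] by auto
  ultimately have "M.span A \<subseteq> {x \<in> carrier M. h x \<in> N.span (h ` A)}"
    by (intro M.span_is_subset) auto
  then have "h x \<in> N.span (h ` A)" if "x \<in> carrier M" for x
    using that unfolding A(3) by blast
  then have "carrier N \<subseteq> N.span (h ` A)"
    unfolding carN by blast
  with N.span_is_subset2[OF hA] have span: "N.span (h ` A) = carrier N"
    by (rule equalityI)
  have "finite (h ` A)" using A(1) by (rule finite_imageI)
  with N hA span have "fg_module R N"
    unfolding fg_module_def by (intro conjI exI[of _ "h ` A"])
  then have 1: "N \<in> mod_cat R" by (simp only: mod_cat_def mem_Collect_eq)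
  have "bij_betw h (carrier M) (carrier N)" using h carN by (simp only: bij_betw_def)
  then have 2: "module_iso R M N" unfolding module_iso_def using hom by (rule bexI)
  from 1 2 show ?thesis by (intro exI[of _ N] conjI)
qed

text \<open>
  Strictly full subcategories are identified with their classes of objects.
\<close>

definition subcategory :: "('a, 'r) ring_scheme \<Rightarrow> ('a, 'b) module set \<Rightarrow> bool"
  where "subcategory R \<X> \<longleftrightarrow>
    \<X> \<subseteq> mod_cat R \<and> (\<forall>M \<in> \<X>. \<forall>N \<in> mod_cat R. module_iso R M N \<longrightarrow> N \<in> \<X>)"

text \<open>
  Membership, up to isomorphism, of a module whose carrier is not a set over \<open>'b\<close>, such as a
  quotient or a tensor product.
\<close>

definition belongs :: "('a, 'r) ring_scheme \<Rightarrow> ('a, 'c) module \<Rightarrow> ('a, 'b) module set \<Rightarrow> bool"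
  where "belongs R N \<X> \<longleftrightarrow> (\<exists>M \<in> \<X>. module_iso R N M)"


section \<open>Quotients and tensor products\<close>

definition quotient_module :: "('a, 'b, 'm) module_scheme \<Rightarrow> 'b set \<Rightarrow> ('a, 'b set) module"
  where "quotient_module M N =
    \<lparr> carrier = a_rcosets\<^bsub>M\<^esub> N,
      mult = (\<lambda>U V. N), one = N,
      zero = N,
      add = (\<lambda>U V. U <+>\<^bsub>M\<^esub> V),
      smult = (\<lambda>a U. \<Union>x\<in>U. N +>\<^bsub>M\<^esub> (a \<odot>\<^bsub>M\<^esub> x)) \<rparr>"

definition free_module :: "('a, 'r) ring_scheme \<Rightarrow> 's set \<Rightarrow> ('a, 's \<Rightarrow> 'a) module"
  where "free_module R S =
    (ring.func_space R S)\<lparr> carrier := {f \<in> S \<rightarrow>\<^sub>E carrier R. finite {s \<in> S. f s \<noteq> \<zero>\<^bsub>R\<^esub>}} \<rparr>"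

definition free_basis :: "('a, 'r) ring_scheme \<Rightarrow> 's set \<Rightarrow> 's \<Rightarrow> 's \<Rightarrow> 'a"
  where "free_basis R S s = (\<lambda>t\<in>S. if t = s then \<one>\<^bsub>R\<^esub> else \<zero>\<^bsub>R\<^esub>)"

lemma free_module_is_module:
  assumes "cring R" shows "module R (free_module R S)"
proof -
  interpret cring R by fact
  interpret F: module R "func_space S" by (rule func_space_is_module)
  have "submodule R {f \<in> S \<rightarrow>\<^sub>E carrier R. finite {s \<in> S. f s \<noteq> \<zero>\<^bsub>R\<^esub>}} (func_space S)"
  proof (unfold submodule_def, intro conjI allI impI)
    fix v w assume "v \<in> {f \<in> S \<rightarrow>\<^sub>E carrier R. finite {s \<in> S. f s \<noteq> \<zero>\<^bsub>R\<^esub>}}"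
        "w \<in> {f \<in> S \<rightarrow>\<^sub>E carrier R. finite {s \<in> S. f s \<noteq> \<zero>\<^bsub>R\<^esub>}}"
    then show "v \<oplus>\<^bsub>func_space S\<^esub> w \<in> {f \<in> S \<rightarrow>\<^sub>E carrier R. finite {s \<in> S. f s \<noteq> \<zero>\<^bsub>R\<^esub>}}"
      by (auto simp: func_space_def intro: finite_subset[of _ "{s \<in> S. v s \<noteq> \<zero>\<^bsub>R\<^esub>} \<union> {s \<in> S. w s \<noteq> \<zero>\<^bsub>R\<^esub>}"])
  next
    fix c v assume "c \<in> carrier R" "v \<in> {f \<in> S \<rightarrow>\<^sub>E carrier R. finite {s \<in> S. f s \<noteq> \<zero>\<^bsub>R\<^esub>}}"
    then show "c \<odot>\<^bsub>func_space S\<^esub> v \<in> {f \<in> S \<rightarrow>\<^sub>E carrier R. finite {s \<in> S. f s \<noteq> \<zero>\<^bsub>R\<^esub>}}"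
      by (auto simp: func_space_def elim!: finite_subset[rotated])
  qed (auto simp: F.module_axioms func_space_def intro: F.module_axioms[unfolded func_space_def])
  from F.submodule_is_module[OF this] show ?thesis
    by (simp add: free_module_def)
qed

lemma quotient_module_is_module:
  assumes "module R M" "submodule R N M"
  shows "module R (quotient_module M N)"
    and "(\<lambda>x. N +>\<^bsub>M\<^esub> x) \<in> module_hom R M (quotient_module M N)"
    and "a_kernel M (quotient_module M N) (\<lambda>x. N +>\<^bsub>M\<^esub> x) = N"
proof -
  interpret M: module R M by fact
  have sub: "N \<subseteq> carrier M" "\<zero>\<^bsub>M\<^esub> \<in> N" "\<And>x y. x \<in> N \<Longrightarrow> y \<in> N \<Longrightarrow> x \<oplus>\<^bsub>M\<^esub> y \<in> N"
     "\<And>a x. a \<in> carrier R \<Longrightarrow> x \<in> N \<Longrightarrow> a \<odot>\<^bsub>M\<^esub> x \<in> N"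
    using assms(2) by (auto simp: submodule_def)
  have neg: "\<ominus>\<^bsub>M\<^esub> x \<in> N" if "x \<in> N" for x
    using sub(4)[of "\<ominus>\<^bsub>R\<^esub> \<one>\<^bsub>R\<^esub>" x] that sub(1) by (auto simp: M.smult_l_minus)
  have "subgroup N (add_monoid M)"
    using sub neg by unfold_locales (auto simp: a_inv_def)
  then interpret N: abelian_subgroup N M
    by (intro abelian_subgroupI3 additive_subgroup.intro M.abelian_group_axioms)
  have add: "(N +>\<^bsub>M\<^esub> x) <+>\<^bsub>M\<^esub> (N +>\<^bsub>M\<^esub> y) = N +>\<^bsub>M\<^esub> (x \<oplus>\<^bsub>M\<^esub> y)" if "x \<in> carrier M" "y \<in> carrier M" for x y
    using that by (simp add: N.a_rcos_sum)
  have eq: "N +>\<^bsub>M\<^esub> x = N +>\<^bsub>M\<^esub> y" if "x \<ominus>\<^bsub>M\<^esub> y \<in> N" "x \<in> carrier M" "y \<in> carrier M" for x y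
    using M.a_repr_independence[of x N y] N.a_rcos_module[of y x] N.a_subgroup that
    by (metis M.a_repr_independence M.minus_eq N.a_rcos_module)
  have mem: "\<exists>n\<in>N. y = n \<oplus>\<^bsub>M\<^esub> x" if "y \<in> N +>\<^bsub>M\<^esub> x" for x y
    using that by (auto simp: a_r_coset_def')
  have smult: "(\<Union>y\<in>N +>\<^bsub>M\<^esub> x. N +>\<^bsub>M\<^esub> (a \<odot>\<^bsub>M\<^esub> y)) = N +>\<^bsub>M\<^esub> (a \<odot>\<^bsub>M\<^esub> x)"
    if "x \<in> carrier M" "a \<in> carrier R" for x a
  proof -
    have "N +>\<^bsub>M\<^esub> (a \<odot>\<^bsub>M\<^esub> y) = N +>\<^bsub>M\<^esub> (a \<odot>\<^bsub>M\<^esub> x)" if y: "y \<in> N +>\<^bsub>M\<^esub> x" for y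
    proof -
      obtain n where n: "n \<in> N" "y = n \<oplus>\<^bsub>M\<^esub> x" using mem[OF y] by auto
      have nc: "n \<in> carrier M" using n sub by auto
      have "(a \<odot>\<^bsub>M\<^esub> y) \<ominus>\<^bsub>M\<^esub> (a \<odot>\<^bsub>M\<^esub> x) = a \<odot>\<^bsub>M\<^esub> n"
        using n nc \<open>x \<in> carrier M\<close> \<open>a \<in> carrier R\<close> by (simp add: M.smult_r_distr M.minus_eq M.add.m_assoc M.r_neg)
      then show ?thesis using n nc sub \<open>x \<in> carrier M\<close> \<open>a \<in> carrier R\<close> by (intro eq) auto
    qed
    moreover have "x \<in> N +>\<^bsub>M\<^esub> x" using that by (simp add: N.a_rcos_self)
    ultimately show ?thesis by blast
  qed
  have N0: "N = N +>\<^bsub>M\<^esub> \<zero>\<^bsub>M\<^esub>" using sub(1) by (simp add: M.a_coset_add_zero)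
  have car: "carrier (quotient_module M N) = (\<lambda>x. N +>\<^bsub>M\<^esub> x) ` carrier M"
    by (auto simp: quotient_module_def A_RCOSETS_def')
  have zeroQ: "\<zero>\<^bsub>quotient_module M N\<^esub> = N +>\<^bsub>M\<^esub> \<zero>\<^bsub>M\<^esub>"
    using N0 by (simp add: quotient_module_def)
  have addQ: "(N +>\<^bsub>M\<^esub> x) \<oplus>\<^bsub>quotient_module M N\<^esub> (N +>\<^bsub>M\<^esub> y) = N +>\<^bsub>M\<^esub> (x \<oplus>\<^bsub>M\<^esub> y)"
    if "x \<in> carrier M" "y \<in> carrier M" for x y
    using add[OF that] by (simp add: quotient_module_def)
  have smultQ: "a \<odot>\<^bsub>quotient_module M N\<^esub> (N +>\<^bsub>M\<^esub> x) = N +>\<^bsub>M\<^esub> (a \<odot>\<^bsub>M\<^esub> x)"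
    if "a \<in> carrier R" "x \<in> carrier M" for a x
    using smult[OF that(2,1)] by (simp add: quotient_module_def)
  have negQ: "\<exists>y\<in>carrier M. N +>\<^bsub>M\<^esub> (x \<oplus>\<^bsub>M\<^esub> y) = N +>\<^bsub>M\<^esub> \<zero>\<^bsub>M\<^esub>" if "x \<in> carrier M" for x
    using that by (intro bexI[of _ "\<ominus>\<^bsub>M\<^esub> x"]) (simp_all add: M.r_neg)
  show "module R (quotient_module M N)"
    by (rule module_criteria)
      (auto simp: car zeroQ addQ smultQ negQ M.smult_assoc1 M.smult_l_distr M.smult_r_distr
        M.a_ac M.R.is_cring simp del: M.a_coset_add_zero)
  show "(\<lambda>x. N +>\<^bsub>M\<^esub> x) \<in> module_hom R M (quotient_module M N)"
    by (auto simp: module_hom_def car addQ smultQ)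
  have "N +>\<^bsub>M\<^esub> x = N \<longleftrightarrow> x \<in> N" if "x \<in> carrier M" for x
    using N.a_rcos_self[OF that] N.a_rcos_const by metis
  then show "a_kernel M (quotient_module M N) (\<lambda>x. N +>\<^bsub>M\<^esub> x) = N"
    using sub(1) by (auto simp: a_kernel_def' quotient_module_def)
qed

text \<open>
  The tensor product is the free module on the set of pairs modulo the usual bilinearity relations.
\<close>

definition tensor_relations ::
    "('a, 'r) ring_scheme \<Rightarrow> ('a, 'b, 'm) module_scheme \<Rightarrow> ('a, 'c, 'n) module_scheme
      \<Rightarrow> ('b \<times> 'c \<Rightarrow> 'a) set"
  where "tensor_relations R M N =
    (let F = free_module R (carrier M \<times> carrier N);
         e = (\<lambda>x y. free_basis R (carrier M \<times> carrier N) (x, y))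
     in {e (x \<oplus>\<^bsub>M\<^esub> x') y \<ominus>\<^bsub>F\<^esub> (e x y \<oplus>\<^bsub>F\<^esub> e x' y) | x x' y.
            x \<in> carrier M \<and> x' \<in> carrier M \<and> y \<in> carrier N}
      \<union> {e x (y \<oplus>\<^bsub>N\<^esub> y') \<ominus>\<^bsub>F\<^esub> (e x y \<oplus>\<^bsub>F\<^esub> e x y') | x y y'.
            x \<in> carrier M \<and> y \<in> carrier N \<and> y' \<in> carrier N}
      \<union> {e (a \<odot>\<^bsub>M\<^esub> x) y \<ominus>\<^bsub>F\<^esub> (a \<odot>\<^bsub>F\<^esub> e x y) | a x y.
            a \<in> carrier R \<and> x \<in> carrier M \<and> y \<in> carrier N}
      \<union> {e x (a \<odot>\<^bsub>N\<^esub> y) \<ominus>\<^bsub>F\<^esub> (a \<odot>\<^bsub>F\<^esub> e x y) | a x y.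
            a \<in> carrier R \<and> x \<in> carrier M \<and> y \<in> carrier N})"

definition tensor_product ::
    "('a, 'r) ring_scheme \<Rightarrow> ('a, 'b, 'm) module_scheme \<Rightarrow> ('a, 'c, 'n) module_scheme
      \<Rightarrow> ('a, ('b \<times> 'c \<Rightarrow> 'a) set) module"
  where "tensor_product R M N =
    (let F = free_module R (carrier M \<times> carrier N)
     in quotient_module F (module.span R F (tensor_relations R M N)))"


section \<open>Closure properties of subcategories\<close>

definition tensor_ideal :: "('a, 'r) ring_scheme \<Rightarrow> ('a, 'b) module set \<Rightarrow> bool"
  where "tensor_ideal R \<X> \<longleftrightarrow>
    (\<forall>(M :: ('a, 'b) module) \<in> mod_cat R. \<forall>X \<in> \<X>. belongs R (tensor_product R M X) \<X>)"

definition direct_summand ::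
    "('a, 'r) ring_scheme \<Rightarrow> ('a, 'b) module \<Rightarrow> ('a, 'b) module \<Rightarrow> bool"
  where "direct_summand R N M \<longleftrightarrow>
    (\<exists>N' :: ('a, 'b) module. N' \<in> mod_cat R \<and> module_iso R M (direct_sum N N'))"

definition closed_under_direct_summands ::
    "('a, 'r) ring_scheme \<Rightarrow> ('a, 'b) module set \<Rightarrow> bool"
  where "closed_under_direct_summands R \<X> \<longleftrightarrow>
    (\<forall>M \<in> \<X>. \<forall>N \<in> mod_cat R. direct_summand R N M \<longrightarrow> N \<in> \<X>)"

definition short_exact ::
    "('a, 'r) ring_scheme \<Rightarrow> ('a, 'b) module \<Rightarrow> ('b \<Rightarrow> 'c) \<Rightarrow> ('a, 'c) module
      \<Rightarrow> ('c \<Rightarrow> 'd) \<Rightarrow> ('a, 'd) module \<Rightarrow> bool"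
  where "short_exact R L f M g N \<longleftrightarrow>
    f \<in> module_hom R L M \<and> g \<in> module_hom R M N \<and>
    inj_on f (carrier L) \<and> f ` carrier L = a_kernel M N g \<and> g ` carrier M = carrier N"

definition closed_under_extensions :: "('a, 'r) ring_scheme \<Rightarrow> ('a, 'b) module set \<Rightarrow> bool"
  where "closed_under_extensions R \<X> \<longleftrightarrow>
    (\<forall>L \<in> \<X>. \<forall>N \<in> \<X>. \<forall>M \<in> mod_cat R. (\<exists>f g. short_exact R L f M g N) \<longrightarrow> M \<in> \<X>)"

definition closed_under_submodules :: "('a, 'r) ring_scheme \<Rightarrow> ('a, 'b) module set \<Rightarrow> bool"
  where "closed_under_submodules R \<X> \<longleftrightarrow>
    (\<forall>M \<in> \<X>. \<forall>N. submodule R N M \<longrightarrow> M\<lparr>carrier := N\<rparr> \<in> \<X>)"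

definition closed_under_quotients :: "('a, 'r) ring_scheme \<Rightarrow> ('a, 'b) module set \<Rightarrow> bool"
  where "closed_under_quotients R \<X> \<longleftrightarrow>
    (\<forall>M \<in> \<X>. \<forall>N. submodule R N M \<longrightarrow> belongs R (quotient_module M N) \<X>)"

definition serre_subcategory :: "('a, 'r) ring_scheme \<Rightarrow> ('a, 'b) module set \<Rightarrow> bool"
  where "serre_subcategory R \<X> \<longleftrightarrow>
    subcategory R \<X> \<and> closed_under_submodules R \<X> \<and> closed_under_quotients R \<X> \<and>
    closed_under_extensions R \<X>"

end

theory Submission
  imports Defs
begin

text \<open>
  Fix \<open>X\<close> in the subcategory. By noetherian induction on the ideal \<open>J \<supseteq> ann X\<close>, every finitely
  generated module annihilated by \<open>J\<close> belongs to the subcategory; applied to \<open>J = ann X\<close> this gives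
  all submodules and quotients of \<open>X\<close>. If \<open>a b \<in> J\<close> with \<open>a, b \<notin> J\<close>, a module \<open>N\<close> killed by \<open>J\<close> is
  an extension of \<open>N / a N\<close> by \<open>a N\<close>, which are killed by strictly larger ideals. If \<open>J = p\<close> is
  prime, filtering by cyclic modules reduces the claim to \<open>R / p\<close>. There is a nonzero homomorphism
  \<open>X \<rightarrow> R / p\<close>, hence one \<open>\<phi> : X' \<rightarrow> R / p\<close> on \<open>X' = R / p \<otimes> X\<close>, which is killed by \<open>p\<close>. Say
  \<open>\<phi> x = s \<noteq> 0\<close>. Then \<open>y \<mapsto> (\<phi> y, y + R x)\<close> embeds \<open>X'\<close> into \<open>R / p \<oplus> X' / R x\<close>, and its cokernel is
  killed by \<open>p\<close> and by \<open>s \<notin> p\<close>, so it belongs to the subcategory by induction. Therefore so do the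
  extension \<open>R / p \<oplus> X' / R x\<close> and its direct summand \<open>R / p\<close>.
\<close>

section \<open>Homomorphisms and submodules\<close>

lemma (in abelian_group) minus_minus_cancel:
  assumes "x \<in> carrier G" "y \<in> carrier G"
  shows "x \<ominus> (x \<ominus> y) = y"
  using assms by (simp add: minus_eq minus_add r_neg2)

text \<open>Serves to compare two ways of writing one element as a multiple of a fixed vector plus a
  remainder from a submodule: the multiples then differ by an element of that submodule.\<close>

lemma (in abelian_group) minus_eq_minus_swap:
  assumes "a \<oplus> q = b \<oplus> r" "a \<in> carrier G" "b \<in> carrier G" "q \<in> carrier G" "r \<in> carrier G"
  shows "a \<ominus> b = r \<ominus> q"
proof -
  have "a = (a \<oplus> q) \<ominus> q" using assms(2-) by (simp add: minus_eq a_assoc r_neg)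
  also have "\<dots> = b \<oplus> (r \<ominus> q)" using assms by (simp add: minus_eq a_assoc)
  finally have "a \<ominus> b = (b \<oplus> (r \<ominus> q)) \<ominus> b" by simp
  also have "\<dots> = \<ominus> b \<oplus> (b \<oplus> (r \<ominus> q))" using assms(2-) by (simp add: minus_eq a_comm)
  also have "\<dots> = r \<ominus> q" using assms(2-) by (simp add: r_neg1)
  finally show ?thesis .
qed

lemma (in submodule) minus_closed:
  assumes "x \<in> N" "y \<in> N"
  shows "x \<ominus> y \<in> N"
proof -
  interpret module R M by (rule module)
  have "x \<oplus> (\<ominus>\<^bsub>R\<^esub> \<one>\<^bsub>R\<^esub>) \<odot> y \<in> N" using assms by simp
  then show ?thesis using assms(2) subsetD[OF subset] by (simp add: smult_minus_1 M.minus_eq)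
qed

lemma (in module) smult_hom:
  assumes "a \<in> carrier R"
  shows "(\<lambda>x. a \<odot>\<^bsub>M\<^esub> x) \<in> module_hom R M M"
  using assms by (auto simp: module_hom_def smult_r_distr smult_assoc_simp R.m_comm)

lemma (in module) smult_left_commute:
  assumes "a \<in> carrier R" "b \<in> carrier R" "x \<in> carrier M"
  shows "a \<odot>\<^bsub>M\<^esub> (b \<odot>\<^bsub>M\<^esub> x) = b \<odot>\<^bsub>M\<^esub> (a \<odot>\<^bsub>M\<^esub> x)"
  using assms by (simp add: smult_assoc_simp R.m_comm)

lemma (in module) cyclic_submodule:
  assumes "v \<in> carrier M"
  shows "submodule R ((\<lambda>a. a \<odot>\<^bsub>M\<^esub> v) ` carrier R) M"
proof (rule submodule.intro)
  fix x y assume "x \<in> (\<lambda>a. a \<odot>\<^bsub>M\<^esub> v) ` carrier R" "y \<in> (\<lambda>a. a \<odot>\<^bsub>M\<^esub> v) ` carrier R"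
  then obtain a b where "a \<in> carrier R" "x = a \<odot>\<^bsub>M\<^esub> v" "b \<in> carrier R" "y = b \<odot>\<^bsub>M\<^esub> v"
    by (elim imageE)
  then show "x \<oplus>\<^bsub>M\<^esub> y \<in> (\<lambda>a. a \<odot>\<^bsub>M\<^esub> v) ` carrier R"
    using assms by (intro image_eqI[of _ _ "a \<oplus>\<^bsub>R\<^esub> b"]) (simp_all add: smult_l_distr)
next
  fix c x assume c: "c \<in> carrier R" and "x \<in> (\<lambda>a. a \<odot>\<^bsub>M\<^esub> v) ` carrier R"
  then obtain a where "a \<in> carrier R" "x = a \<odot>\<^bsub>M\<^esub> v" by (elim imageE)
  with c show "c \<odot>\<^bsub>M\<^esub> x \<in> (\<lambda>a. a \<odot>\<^bsub>M\<^esub> v) ` carrier R"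
    using assms by (intro image_eqI[of _ _ "c \<otimes>\<^bsub>R\<^esub> a"]) (simp_all add: smult_assoc1)
next
  show "\<zero>\<^bsub>M\<^esub> \<in> (\<lambda>a. a \<odot>\<^bsub>M\<^esub> v) ` carrier R"
    using assms by (intro image_eqI[of _ _ "\<zero>\<^bsub>R\<^esub>"]) simp_all
qed (use assms in \<open>auto simp: module_axioms\<close>)

lemma mod_homI:
  assumes "module R M" "module R N" "f \<in> module_hom R M N"
  shows "mod_hom R M N f"
  using assms by (simp add: mod_hom_def mod_hom_axioms_def)

lemma module_hom_compose:
  assumes "f \<in> module_hom R L M" "g \<in> module_hom R M N"
  shows "(\<lambda>x. g (f x)) \<in> module_hom R L N"
  using assms by (auto simp: module_hom_def Pi_iff)

lemma submodule_vimage: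
  assumes "module R M" "module R N" "f \<in> module_hom R M N" "submodule R L N"
  shows "submodule R {x \<in> carrier M. f x \<in> L} M"
proof -
  interpret mod_hom R M N f using assms by (intro mod_homI)
  show ?thesis using assms(4) by (auto simp: submodule_def M.module_axioms)
qed

lemma submodule_image:
  assumes "module R M" "module R N" "f \<in> module_hom R M N"
  shows "submodule R (f ` carrier M) N"
proof -
  interpret mod_hom R M N f using assms by (intro mod_homI)
  show ?thesis using im_is_submodule by (simp add: im_def)
qed

lemma module_iso_sym:
  assumes "module R M" "module_iso R M N"
  shows "module_iso R N M"
proof -
  interpret module R M by fact
  obtain f where f: "f \<in> module_hom R M N" "bij_betw f (carrier M) (carrier N)"
    using assms(2) by (auto simp: module_iso_def)
  define g where "g = inv_into (carrier M) f"
  have b: "bij_betw g (carrier N) (carrier M)"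
    unfolding g_def by (rule bij_betw_inv_into[OF f(2)])
  have fg: "f (g y) = y" if "y \<in> carrier N" for y
    using f(2) that by (simp add: g_def bij_betw_inv_into_right)
  have gf: "g (f x) = x" if "x \<in> carrier M" for x
    using f(2) that by (simp add: g_def bij_betw_inv_into_left)
  have gc: "g y \<in> carrier M" if "y \<in> carrier N" for y
    using b that by (rule bij_betwE[rule_format])
  have "g (y \<oplus>\<^bsub>N\<^esub> z) = g y \<oplus>\<^bsub>M\<^esub> g z" if "y \<in> carrier N" "z \<in> carrier N" for y z
    using gf[of "g y \<oplus>\<^bsub>M\<^esub> g z"] that gc fg by (simp add: module_hom_add[OF f(1)])
  moreover have "g (a \<odot>\<^bsub>N\<^esub> y) = a \<odot>\<^bsub>M\<^esub> g y" if "a \<in> carrier R" "y \<in> carrier N" for a y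
    using gf[of "a \<odot>\<^bsub>M\<^esub> g y"] that gc fg by (simp add: module_hom_smult[OF f(1)])
  ultimately have "g \<in> module_hom R N M" using gc by (auto simp: module_hom_def)
  with b show ?thesis by (auto simp: module_iso_def)
qed

text \<open>The value at \<open>p x\<close> is \<open>f\<close> of a chosen preimage. Two preimages
  differ by an element of the kernel of \<open>p\<close>, where \<open>f\<close> vanishes, so the
  choice does not matter.\<close>

lemma module_hom_factor:
  assumes "module R M" "module R Q" "module R N"
    and p: "p \<in> module_hom R M Q" "p ` carrier M = carrier Q"
    and f: "f \<in> module_hom R M N" and ker: "\<And>x. x \<in> carrier M \<Longrightarrow> p x = \<zero>\<^bsub>Q\<^esub> \<Longrightarrow> f x = \<zero>\<^bsub>N\<^esub>"
  shows "\<exists>g \<in> module_hom R Q N. \<forall>x \<in> carrier M. g (p x) = f x"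
proof -
  interpret p: mod_hom R M Q p using assms by (intro mod_homI)
  interpret f: mod_hom R M N f using assms by (intro mod_homI)
  define g where "g y = f (inv_into (carrier M) p y)" for y
  have g: "g (p x) = f x" if x: "x \<in> carrier M" for x
  proof -
    let ?y = "inv_into (carrier M) p (p x)"
    have y: "?y \<in> carrier M" "p ?y = p x"
      using x by (auto intro: inv_into_into f_inv_into_f)
    then have "p (?y \<ominus>\<^bsub>M\<^esub> x) = \<zero>\<^bsub>Q\<^esub>" using x by (simp del: p.N.M.minus_other_side) simp
    then have "f (?y \<ominus>\<^bsub>M\<^esub> x) = \<zero>\<^bsub>N\<^esub>" using x y by (intro ker) auto
    then show ?thesis using x y by (simp add: g_def)
  qed
  have "g \<in> module_hom R Q N"
    unfolding module_hom_def
  proof (intro CollectI conjI allI impI Pi_I)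
    fix y assume "y \<in> carrier Q"
    then obtain x where "x \<in> carrier M" "y = p x" unfolding p(2)[symmetric] by (rule imageE)
    then show "g y \<in> carrier N" by (simp add: g)
  next
    fix y z assume "y \<in> carrier Q \<and> z \<in> carrier Q"
    then obtain x w where "x \<in> carrier M" "y = p x" "w \<in> carrier M" "z = p w"
      unfolding p(2)[symmetric] by (elim conjE imageE)
    then show "g (y \<oplus>\<^bsub>Q\<^esub> z) = g y \<oplus>\<^bsub>N\<^esub> g z" using g[of "x \<oplus>\<^bsub>M\<^esub> w"] by (simp add: g)
  next
    fix a y assume "a \<in> carrier R \<and> y \<in> carrier Q"
    then obtain x where "a \<in> carrier R" "x \<in> carrier M" "y = p x"
      unfolding p(2)[symmetric] by (elim conjE imageE)
    then show "g (a \<odot>\<^bsub>Q\<^esub> y) = a \<odot>\<^bsub>N\<^esub> g y" using g[of "a \<odot>\<^bsub>M\<^esub> x"] by (simp add: g)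
  qed
  then show ?thesis by (intro bexI[of _ g] ballI g)
qed

section \<open>Finitely generated modules, their images and direct sums\<close>

lemma fg_moduleI:
  assumes "module R M" "finite A" "A \<subseteq> carrier M"
    and "\<And>N. submodule R N M \<Longrightarrow> A \<subseteq> N \<Longrightarrow> carrier M \<subseteq> N"
  shows "fg_module R M"
proof -
  interpret module R M by fact
  have "span A = carrier M"
    by (intro equalityI span_is_subset2 assms span_is_submodule in_own_span)
  with assms show ?thesis by (auto simp: fg_module_def)
qed

lemma fg_moduleE:
  assumes "fg_module R M"
  obtains A where "finite A" "A \<subseteq> carrier M"
    "\<And>N. submodule R N M \<Longrightarrow> A \<subseteq> N \<Longrightarrow> carrier M \<subseteq> N"
proof -
  interpret module R M using assms by (simp add: fg_module_def)
  obtain A where A: "finite A" "A \<subseteq> carrier M" "span A = carrier M"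
    using assms by (auto simp: fg_module_def)
  then show ?thesis using span_is_subset[of A] by (intro that[of A]) auto
qed

text \<open>Generation is tested on submodules rather than by linear combinations: if
  \<open>L\<close> contains the images of the generators, its preimage is a submodule containing the
  generators, hence everything.\<close>

lemma fg_module_image:
  assumes "fg_module R M" "module R N" "f \<in> module_hom R M N" "f ` carrier M = carrier N"
  shows "fg_module R N"
proof -
  have M: "module R M" using assms(1) by (simp add: fg_module_def)
  obtain A where A: "finite A" "A \<subseteq> carrier M"
    "\<And>N. submodule R N M \<Longrightarrow> A \<subseteq> N \<Longrightarrow> carrier M \<subseteq> N"
    using fg_moduleE[OF assms(1)] by blast
  show ?thesis
  proof (rule fg_moduleI)
    fix L assume L: "submodule R L N" "f ` A \<subseteq> L"
    have "carrier M \<subseteq> {x \<in> carrier M. f x \<in> L}"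
      using A L by (intro A(3) submodule_vimage[OF M]) (auto simp: assms)
    then show "carrier N \<subseteq> L"
      unfolding assms(4)[symmetric] image_subset_iff by blast
  qed (use A assms in auto)
qed

text \<open>Generators of the summands, padded with zeros, generate the sum: the preimages of
  \<open>L\<close> under both injections are everything, and
  \<open>(x, y) = (x, 0) + (0, y)\<close>.\<close>

lemma fg_module_direct_sum:
  assumes "fg_module R M" "fg_module R N"
  shows "fg_module R (direct_sum M N)"
proof -
  have M: "module R M" and N: "module R N" using assms by (simp_all add: fg_module_def)
  then interpret M: module R M + N: module R N .
  interpret D: module R "direct_sum M N" by (rule direct_sum_is_module[OF M N])
  obtain A where A: "finite A" "A \<subseteq> carrier M"
    "\<And>L. submodule R L M \<Longrightarrow> A \<subseteq> L \<Longrightarrow> carrier M \<subseteq> L"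
    using fg_moduleE[OF assms(1)] by blast
  obtain B where B: "finite B" "B \<subseteq> carrier N"
    "\<And>L. submodule R L N \<Longrightarrow> B \<subseteq> L \<Longrightarrow> carrier N \<subseteq> L"
    using fg_moduleE[OF assms(2)] by blast
  have i1: "(\<lambda>x. (x, \<zero>\<^bsub>N\<^esub>)) \<in> module_hom R M (direct_sum M N)"
    and i2: "(\<lambda>y. (\<zero>\<^bsub>M\<^esub>, y)) \<in> module_hom R N (direct_sum M N)"
    by (auto simp: module_hom_def direct_sum_def)
  show ?thesis
  proof (rule fg_moduleI)
    fix L assume L: "submodule R L (direct_sum M N)"
      "(\<lambda>x. (x, \<zero>\<^bsub>N\<^esub>)) ` A \<union> (\<lambda>y. (\<zero>\<^bsub>M\<^esub>, y)) ` B \<subseteq> L"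
    have 1: "carrier M \<subseteq> {x \<in> carrier M. (x, \<zero>\<^bsub>N\<^esub>) \<in> L}"
      using A L by (intro A(3) submodule_vimage[OF M D.module_axioms i1]) auto
    have 2: "carrier N \<subseteq> {y \<in> carrier N. (\<zero>\<^bsub>M\<^esub>, y) \<in> L}"
      using B L by (intro B(3) submodule_vimage[OF N D.module_axioms i2]) auto
    show "carrier (direct_sum M N) \<subseteq> L"
    proof
      fix z assume "z \<in> carrier (direct_sum M N)"
      then obtain x y where z: "z = (x, y)" "x \<in> carrier M" "y \<in> carrier N"
        by (auto simp: direct_sum_def)
      then have "(x, \<zero>\<^bsub>N\<^esub>) \<oplus>\<^bsub>direct_sum M N\<^esub> (\<zero>\<^bsub>M\<^esub>, y) \<in> L"
        using 1 2 L(1) by (intro submodule.m_closed[OF L(1)]) auto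
      then show "z \<in> L" using z by (simp add: direct_sum_def)
    qed
  qed (use A B D.module_axioms in \<open>auto simp: direct_sum_def\<close>)
qed

section \<open>Submodules of finitely generated modules over a noetherian ring\<close>

lemma (in module) mem_submodule_sum:
  "x \<in> submodule_sum N P \<longleftrightarrow> (\<exists>n\<in>N. \<exists>y\<in>P. x = n \<oplus>\<^bsub>M\<^esub> y)"
  by (force simp: submodule_sum_def)

text \<open>This is the colon ideal \<open>N : v\<close>. With \<open>N + span A\<close> in place of
  \<open>N\<close> it consists of the coefficients \<open>a\<close> such that \<open>a v + y\<close>
  lies in \<open>N\<close> for some \<open>y\<close> in \<open>span A\<close>.\<close>

lemma (in module) colon_ideal:
  assumes "submodule R N M" "v \<in> carrier M"
  shows "ideal {a \<in> carrier R. a \<odot>\<^bsub>M\<^esub> v \<in> N} R"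
proof (rule idealI)
  have sub: "N \<subseteq> carrier M" and neg: "\<And>x. x \<in> N \<Longrightarrow> \<ominus>\<^bsub>M\<^esub> x \<in> N"
    using submodule.subset[OF assms(1)] submodule.smult_closed[OF assms(1), of "\<ominus>\<^bsub>R\<^esub> \<one>\<^bsub>R\<^esub>"]
    by (auto simp: smult_minus_1 subset_iff)
  show "subgroup {a \<in> carrier R. a \<odot>\<^bsub>M\<^esub> v \<in> N} (add_monoid R)"
    using assms sub neg
    by (intro R.add.subgroupI)
      (auto simp: smult_l_distr smult_l_minus submodule_def simp flip: a_inv_def)
  show l: "x \<otimes>\<^bsub>R\<^esub> a \<in> {a \<in> carrier R. a \<odot>\<^bsub>M\<^esub> v \<in> N}"
    if "a \<in> {a \<in> carrier R. a \<odot>\<^bsub>M\<^esub> v \<in> N}" "x \<in> carrier R" for a x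
    using that assms by (auto simp: smult_assoc1 submodule_def)
  show "a \<otimes>\<^bsub>R\<^esub> x \<in> {a \<in> carrier R. a \<odot>\<^bsub>M\<^esub> v \<in> N}"
    if "a \<in> {a \<in> carrier R. a \<odot>\<^bsub>M\<^esub> v \<in> N}" "x \<in> carrier R" for a x
    using l[OF that] that by (simp add: R.m_comm)
qed (rule ring_axioms)

lemma (in module) span_insertE:
  assumes "x \<in> span (insert v A)" "v \<in> carrier M" "A \<subseteq> carrier M"
  obtains a y where "a \<in> carrier R" "y \<in> span A" "x = a \<odot>\<^bsub>M\<^esub> v \<oplus>\<^bsub>M\<^esub> y"
proof -
  have "x \<in> submodule_sum (span {v}) (span A)"
    using assms span_union_is_sum[of "{v}" A] by simp
  then obtain w y where w: "w \<in> span {v}" "y \<in> span A" "x = w \<oplus>\<^bsub>M\<^esub> y"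
    by (auto simp: mem_submodule_sum)
  then obtain a where "a \<in> {v} \<rightarrow> carrier R" "lincomb a {v} = w"
    using finite_in_span[of "{v}" w] assms by auto
  then show thesis using w assms(2) by (intro that[of "a v" y]) (auto simp: lincomb_def)
qed

text \<open>The coefficients at \<open>v\<close> of elements of \<open>N\<close> form an ideal
  \<open>I\<close>. Finitely many elements of \<open>N\<close> realise generators of
  \<open>I\<close>, and together with generators of \<open>N \<inter> span A\<close> they generate
  \<open>N\<close>.\<close>

lemma (in module) noetherian_submodule:
  assumes "noetherian_ring R" "finite A" "A \<subseteq> carrier M" "submodule R N M" "N \<subseteq> span A"
  shows "\<exists>B \<subseteq> N. finite B \<and> span B = N"
  using assms(2-)
proof (induction A arbitrary: N rule: finite_induct)
  case empty
  have "span {} = {\<zero>\<^bsub>M\<^esub>}" by (auto simp: span_def lincomb_def)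
  with empty show ?case by (intro exI[of _ "{}"]) (auto simp: submodule_def)
next
  case (insert v A)
  interpret noetherian_ring R by fact
  have A: "A \<subseteq> carrier M" and v: "v \<in> carrier M" using insert.prems by auto
  have sA: "submodule R (span A) M" by (rule span_is_submodule[OF A])
  have sub: "submodule R (N \<inter> span A) M" using insert.prems(2) sA by (auto simp: submodule_def)
  then obtain B where B: "B \<subseteq> N \<inter> span A" "finite B" "span B = N \<inter> span A"
    using insert.IH[OF A sub] by auto
  define I where "I = {a \<in> carrier R. a \<odot>\<^bsub>M\<^esub> v \<in> submodule_sum N (span A)}"
  have "ideal I R" unfolding I_def by (intro colon_ideal sum_is_submodule insert.prems sA v)
  then obtain S where S: "S \<subseteq> carrier R" "finite S" "I = Idl S" using finetely_gen by blast
  have "S \<subseteq> I" using S genideal_self by blast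
  then have "\<forall>s\<in>S. \<exists>n\<in>N. \<exists>y\<in>span A. s \<odot>\<^bsub>M\<^esub> v = n \<oplus>\<^bsub>M\<^esub> y"
    by (auto simp: I_def mem_submodule_sum)
  then obtain n where n: "\<And>s. s \<in> S \<Longrightarrow> n s \<in> N \<and> (\<exists>y\<in>span A. s \<odot>\<^bsub>M\<^esub> v = n s \<oplus>\<^bsub>M\<^esub> y)"
    using bchoice[of S "\<lambda>s m. m \<in> N \<and> (\<exists>y\<in>span A. s \<odot>\<^bsub>M\<^esub> v = m \<oplus>\<^bsub>M\<^esub> y)"] by blast
  have NM: "N \<subseteq> carrier M" using insert.prems(2) by (simp add: submodule_def)
  let ?B = "n ` S \<union> B"
  have nS: "n ` S \<subseteq> N" using n by blast
  then have BN: "?B \<subseteq> N" using B(1) by blast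
  have sB: "submodule R (span (n ` S)) M" using nS NM by (intro span_is_submodule) auto
  \<comment> \<open>The right side is an ideal, so only the generators \<open>S\<close> of
    \<open>I\<close> have to be tested; for these, \<open>n s\<close> differs from
    \<open>s v\<close> by an element of \<open>span A\<close>.\<close>
  have "Idl S \<subseteq> {a \<in> carrier R. a \<odot>\<^bsub>M\<^esub> v \<in> submodule_sum (span (n ` S)) (span A)}"
  proof (rule genideal_minimal)
    show "S \<subseteq> {a \<in> carrier R. a \<odot>\<^bsub>M\<^esub> v \<in> submodule_sum (span (n ` S)) (span A)}"
    proof
      fix s assume s: "s \<in> S"
      then obtain y where y: "y \<in> span A" "s \<odot>\<^bsub>M\<^esub> v = n s \<oplus>\<^bsub>M\<^esub> y" using n by blast
      have "n s \<in> span (n ` S)" using in_own_span[of "n ` S"] nS NM s by blast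
      with s y S show "s \<in> {a \<in> carrier R. a \<odot>\<^bsub>M\<^esub> v \<in> submodule_sum (span (n ` S)) (span A)}"
        by (auto simp: mem_submodule_sum)
    qed
  qed (intro colon_ideal sum_is_submodule sA sB v)
  then have I: "a \<odot>\<^bsub>M\<^esub> v \<in> submodule_sum (span (n ` S)) (span A)" if "a \<in> I" for a
    using that S by blast
  have span_nS: "span (n ` S) \<subseteq> N" by (intro span_is_subset nS insert.prems)
  have "N \<subseteq> span ?B"
  proof
    fix x assume x: "x \<in> N"
    then obtain a y where a: "a \<in> carrier R" "y \<in> span A" "x = a \<odot>\<^bsub>M\<^esub> v \<oplus>\<^bsub>M\<^esub> y"
      using span_insertE[of x v A] insert.prems v by blast
    have yM: "y \<in> carrier M" "\<ominus>\<^bsub>M\<^esub> y \<in> span A"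
      using a(2) sA submodule.smult_closed[OF sA, of "\<ominus>\<^bsub>R\<^esub> \<one>\<^bsub>R\<^esub>" y] submodule.subset[OF sA]
      by (auto simp: smult_minus_1 subset_iff)
    have "a \<odot>\<^bsub>M\<^esub> v = x \<oplus>\<^bsub>M\<^esub> \<ominus>\<^bsub>M\<^esub> y" using a yM v by (simp add: M.a_assoc M.r_neg)
    then have "a \<in> I" using x a(1) yM unfolding I_def mem_submodule_sum by blast
    then obtain w z where w: "w \<in> span (n ` S)" "z \<in> span A" "a \<odot>\<^bsub>M\<^esub> v = w \<oplus>\<^bsub>M\<^esub> z"
      using I[of a] unfolding mem_submodule_sum by blast
    have wN: "w \<in> N" using w(1) span_nS by blast
    have zM: "z \<in> carrier M" using w(2) submodule.subset[OF sA] by blast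
    have wM: "w \<in> carrier M" using wN NM by blast
    \<comment> \<open>Subtracting \<open>w\<close> from \<open>x\<close> removes the multiple of
      \<open>v\<close>. What is left lies both in \<open>N\<close> and in \<open>span A\<close>,
      hence in \<open>span B\<close>.\<close>
    have xw: "x = w \<oplus>\<^bsub>M\<^esub> (z \<oplus>\<^bsub>M\<^esub> y)" using a w zM wM yM by (simp add: M.a_assoc)
    have zy: "z \<oplus>\<^bsub>M\<^esub> y \<in> span A" using w a submodule.m_closed[OF sA] by blast
    have "z \<oplus>\<^bsub>M\<^esub> y = \<ominus>\<^bsub>M\<^esub> w \<oplus>\<^bsub>M\<^esub> x" unfolding xw using zM wM yM by (simp add: M.r_neg1)
    moreover have "\<ominus>\<^bsub>M\<^esub> w \<in> N"
      using submodule.smult_closed[OF insert.prems(2), of "\<ominus>\<^bsub>R\<^esub> \<one>\<^bsub>R\<^esub>" w] wN wM by (simp add: smult_minus_1)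
    ultimately have "z \<oplus>\<^bsub>M\<^esub> y \<in> N" using x submodule.m_closed[OF insert.prems(2)] by metis
    then have "z \<oplus>\<^bsub>M\<^esub> y \<in> span B" using zy B by blast
    then have "x \<in> submodule_sum (span (n ` S)) (span B)"
      unfolding mem_submodule_sum using w(1) xw by blast
    moreover have "n ` S \<subseteq> carrier M" "B \<subseteq> carrier M" using nS NM B(1) by blast+
    ultimately show "x \<in> span ?B" by (simp only: span_union_is_sum)
  qed
  moreover have "span ?B \<subseteq> N" by (intro span_is_subset BN insert.prems)
  ultimately show ?case using BN S(2) B(2) by (intro exI[of _ ?B]) auto
qed

section \<open>Annihilators\<close>

definition annihilator :: "('a, 'r) ring_scheme \<Rightarrow> ('a, 'b, 'm) module_scheme \<Rightarrow> 'a set"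
  where "annihilator R M = {a \<in> carrier R. \<forall>x \<in> carrier M. a \<odot>\<^bsub>M\<^esub> x = \<zero>\<^bsub>M\<^esub>}"

lemma annihilator_ideal:
  assumes "module R M" shows "ideal (annihilator R M) R"
proof -
  interpret module R M by fact
  show ?thesis
  proof (rule idealI)
    show "subgroup (annihilator R M) (add_monoid R)"
      by (intro R.add.subgroupI)
        (auto simp: annihilator_def smult_l_distr smult_l_minus simp flip: a_inv_def)
  qed (auto simp: annihilator_def smult_assoc1 ring_axioms)
qed

lemma annihilator_submodule:
  assumes "submodule R N M"
  shows "annihilator R M \<subseteq> annihilator R (M\<lparr>carrier := N\<rparr>)"
  using submodule.subset[OF assms] by (auto simp: annihilator_def)

lemma annihilator_image:
  assumes "module R M" "module R N" "f \<in> module_hom R M N" "f ` carrier M = carrier N"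
  shows "annihilator R M \<subseteq> annihilator R N"
proof -
  interpret mod_hom R M N f using assms by (intro mod_homI)
  show ?thesis
    unfolding annihilator_def assms(4)[symmetric] by (auto simp flip: f_smult)
qed

text \<open>In a noetherian ring the union of a nonempty chain of ideals is a member of the chain,
  so Zorn's lemma turns a counterexample into a maximal one. All strictly larger ideals satisfy
  \<open>P\<close>, and \<open>step\<close> gives a contradiction.\<close>

lemma (in noetherian_ring) noetherian_ideal_induct [consumes 1, case_names ideal]:
  assumes "ideal I R"
    and step: "\<And>J. ideal J R \<Longrightarrow> (\<And>J'. ideal J' R \<Longrightarrow> J \<subset> J' \<Longrightarrow> P J') \<Longrightarrow> P J"
  shows "P I"
proof (rule ccontr)
  assume "\<not> P I"
  define B where "B = {J. ideal J R \<and> \<not> P J}"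
  have "B \<noteq> {}" using assms(1) \<open>\<not> P I\<close> by (auto simp: B_def)
  moreover have "\<Union>C \<in> B" if "C \<noteq> {}" "subset.chain B C" for C
  proof -
    have "subset.chain {J. ideal J R} C" using that(2) by (auto simp: subset_chain_def B_def)
    then have "\<Union>C \<in> C" by (rule ideal_chain_is_trivial[OF that(1)])
    then show ?thesis using that(2) by (auto simp: subset_chain_def)
  qed
  ultimately obtain J where J: "J \<in> B" "\<And>J'. J' \<in> B \<Longrightarrow> J \<subseteq> J' \<Longrightarrow> J' = J"
    using subset_Zorn_nonempty[of B] by blast
  have "P J" by (rule step) (use J in \<open>auto simp: B_def\<close>)
  then show False using J(1) by (simp add: B_def)
qed

section \<open>Nonzero homomorphisms into a cyclic module with prime annihilator\<close>

text \<open>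
  Take a submodule \<open>Q\<close> maximal among those for which no \<open>t \<notin> p\<close> satisfies \<open>t X \<subseteq> Q\<close>, and some
  \<open>x1 \<notin> Q\<close>. By maximality \<open>s X \<subseteq> R x1 + Q\<close> for some \<open>s \<notin> p\<close>, and the coefficient of \<open>x1\<close> in \<open>s y\<close>
  is well defined modulo \<open>p\<close>.
\<close>

lemma nonzero_hom_to_prime_cyclic:
  assumes X: "fg_module R X" and p: "primeideal p R" and ann: "annihilator R X \<subseteq> p"
    and M: "module R M" and u: "u \<in> carrier M" "{a \<in> carrier R. a \<odot>\<^bsub>M\<^esub> u = \<zero>\<^bsub>M\<^esub>} = p"
  shows "\<exists>\<phi> \<in> module_hom R X M. \<exists>x \<in> carrier X. \<phi> x \<noteq> \<zero>\<^bsub>M\<^esub>"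
proof -
  interpret X: module R X using X by (simp add: fg_module_def)
  interpret M: module R M by fact
  interpret p: primeideal p R by fact
  obtain A where A: "finite A" "A \<subseteq> carrier X"
    "\<And>N. submodule R N X \<Longrightarrow> A \<subseteq> N \<Longrightarrow> carrier X \<subseteq> N"
    using fg_moduleE[OF X] by blast
  \<comment> \<open>Since \<open>X\<close> is finitely generated, these are the submodules
    \<open>Q\<close> for which \<open>X / Q\<close> has a nonzero localization at \<open>p\<close>;
    the condition is phrased without forming the localization.\<close>
  define \<Q> where "\<Q> = {Q. submodule R Q X \<and> (\<forall>t\<in>carrier R - p. \<exists>x\<in>carrier X. t \<odot>\<^bsub>X\<^esub> x \<notin> Q)}"
  have prod: "a \<otimes>\<^bsub>R\<^esub> b \<notin> p" if "a \<in> carrier R - p" "b \<in> carrier R - p" for a b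
    using that p.I_prime by blast
  have "{\<zero>\<^bsub>X\<^esub>} \<in> \<Q>"
  proof -
    have "submodule R {\<zero>\<^bsub>X\<^esub>} X" by (auto simp: submodule_def X.module_axioms)
    moreover have "\<exists>x\<in>carrier X. t \<odot>\<^bsub>X\<^esub> x \<notin> {\<zero>\<^bsub>X\<^esub>}" if "t \<in> carrier R - p" for t
      using that ann by (auto simp: annihilator_def)
    ultimately show ?thesis by (simp add: \<Q>_def)
  qed
  moreover have "\<Union>C \<in> \<Q>" if C: "C \<noteq> {}" "subset.chain \<Q> C" for C
  proof -
    have sub: "submodule R Q X" if "Q \<in> C" for Q
      using C that by (auto simp: subset.chain_def \<Q>_def)
    have lin: "Q \<subseteq> Q' \<or> Q' \<subseteq> Q" if "Q \<in> C" "Q' \<in> C" for Q Q'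
      using C that by (auto simp: subset_chain_def)
    have "submodule R (\<Union>C) X"
    proof (rule X.nested_union_vs[of C "\<lambda>Q. Q"])
      fix Q Q' assume "Q \<in> C" "Q' \<in> C"
      then show "\<exists>k. k \<in> C \<and> Q \<subseteq> k \<and> Q' \<subseteq> k" using lin[of Q Q'] by auto
    qed (simp_all add: sub C(1))
    moreover have "\<exists>x\<in>carrier X. t \<odot>\<^bsub>X\<^esub> x \<notin> \<Union>C" if t: "t \<in> carrier R - p" for t
    proof (rule ccontr)
      assume "\<not> ?thesis"
      \<comment> \<open>Finite generation enters here: the finite set \<open>t A\<close> already
        lies in one member of the chain, which then contains \<open>t X\<close>.\<close>
      then have "(\<lambda>x. t \<odot>\<^bsub>X\<^esub> x) ` A \<subseteq> \<Union>C" using A(2) by blast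
      then obtain Q where Q: "Q \<in> C" "(\<lambda>x. t \<odot>\<^bsub>X\<^esub> x) ` A \<subseteq> Q"
        using finite_subset_Union_chain[OF finite_imageI[OF A(1)] _ C] by metis
      have "carrier X \<subseteq> {x \<in> carrier X. t \<odot>\<^bsub>X\<^esub> x \<in> Q}"
      proof (rule A(3))
        have "(\<lambda>x. t \<odot>\<^bsub>X\<^esub> x) \<in> module_hom R X X"
          using t by (intro X.smult_hom) simp
        then show "submodule R {x \<in> carrier X. t \<odot>\<^bsub>X\<^esub> x \<in> Q} X"
          by (rule submodule_vimage[OF X.module_axioms X.module_axioms _ sub[OF Q(1)]])
      qed (use A(2) Q(2) in blast)
      moreover have "Q \<in> \<Q>" using C Q by (auto simp: subset.chain_def)
      ultimately show False using t by (auto simp: \<Q>_def)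
    qed
    ultimately show ?thesis by (simp add: \<Q>_def)
  qed
  ultimately obtain Q where Q: "Q \<in> \<Q>" and max: "\<And>Q'. Q' \<in> \<Q> \<Longrightarrow> Q \<subseteq> Q' \<Longrightarrow> Q' = Q"
    using subset_Zorn_nonempty[of \<Q>] by blast
  have sQ: "submodule R Q X" using Q by (simp add: \<Q>_def)
  interpret Q: submodule R Q X by fact
  have QX: "x \<in> carrier X" if "x \<in> Q" for x using that Q.subset by blast
  \<comment> \<open>By maximality of \<open>Q\<close>, the strictly larger submodule
    \<open>R y + Q\<close> is not in \<open>\<Q>\<close>, so some \<open>t\<close> outside
    \<open>p\<close> maps \<open>X\<close> into it.\<close>
  have gen: "\<exists>t\<in>carrier R - p. \<forall>x\<in>carrier X. \<exists>a\<in>carrier R. \<exists>q\<in>Q. t \<odot>\<^bsub>X\<^esub> x = a \<odot>\<^bsub>X\<^esub> y \<oplus>\<^bsub>X\<^esub> q"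
    if y: "y \<in> carrier X" "y \<notin> Q" for y
  proof -
    let ?Y = "(\<lambda>a. a \<odot>\<^bsub>X\<^esub> y) ` carrier R"
    let ?Q = "X.submodule_sum ?Y Q"
    have sY: "submodule R ?Y X" by (rule X.cyclic_submodule[OF y(1)])
    have s: "submodule R ?Q X" by (rule X.sum_is_submodule[OF sY sQ])
    have "Q \<subseteq> ?Q" using X.in_sum[OF sQ sY] X.msum_comm[OF sQ sY] by simp
    moreover have "y \<in> ?Y" using y(1) by (intro image_eqI[of _ _ "\<one>\<^bsub>R\<^esub>"]) auto
    then have "y \<in> ?Q" using X.in_sum[OF sY sQ] by blast
    ultimately have "?Q \<notin> \<Q>" using max[of ?Q] y(2) by blast
    then have "\<exists>t\<in>carrier R - p. \<forall>x\<in>carrier X. t \<odot>\<^bsub>X\<^esub> x \<in> ?Q" using s unfolding \<Q>_def by blast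
    then show ?thesis unfolding X.mem_submodule_sum by blast
  qed
  have "\<one>\<^bsub>R\<^esub> \<in> carrier R - p" using p.one_imp_carrier p.I_notcarr by auto
  then have "\<exists>x\<in>carrier X. \<one>\<^bsub>R\<^esub> \<odot>\<^bsub>X\<^esub> x \<notin> Q" using Q unfolding \<Q>_def by blast
  then obtain x1 where x1: "x1 \<in> carrier X" "x1 \<notin> Q" by auto
  obtain s where s: "s \<in> carrier R - p"
    and s_gen: "\<And>x. x \<in> carrier X \<Longrightarrow> \<exists>a\<in>carrier R. \<exists>q\<in>Q. s \<odot>\<^bsub>X\<^esub> x = a \<odot>\<^bsub>X\<^esub> x1 \<oplus>\<^bsub>X\<^esub> q"
    using gen[OF x1] by blast
  \<comment> \<open>Otherwise \<open>a s\<close> would lie outside \<open>p\<close> and map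
    \<open>X\<close> into \<open>Q\<close>, because \<open>s x\<close> is a multiple of
    \<open>x1\<close> plus an element of \<open>Q\<close>.\<close>
  have colon: "a \<in> p" if a: "a \<in> carrier R" and aQ: "a \<odot>\<^bsub>X\<^esub> x1 \<in> Q" for a
  proof (rule ccontr)
    assume "a \<notin> p"
    then have "a \<otimes>\<^bsub>R\<^esub> s \<in> carrier R - p" using prod a s by auto
    moreover have "(a \<otimes>\<^bsub>R\<^esub> s) \<odot>\<^bsub>X\<^esub> x \<in> Q" if x: "x \<in> carrier X" for x
    proof -
      obtain b q where b: "b \<in> carrier R" "q \<in> Q" "s \<odot>\<^bsub>X\<^esub> x = b \<odot>\<^bsub>X\<^esub> x1 \<oplus>\<^bsub>X\<^esub> q"
        using s_gen[OF x] by blast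
      then have "(a \<otimes>\<^bsub>R\<^esub> s) \<odot>\<^bsub>X\<^esub> x = b \<odot>\<^bsub>X\<^esub> (a \<odot>\<^bsub>X\<^esub> x1) \<oplus>\<^bsub>X\<^esub> a \<odot>\<^bsub>X\<^esub> q"
        using a s x x1(1) QX
        by (simp add: X.smult_assoc1 X.smult_r_distr) (simp add: X.smult_assoc_simp X.R.m_comm)
      then show ?thesis using aQ b a by simp
    qed
    ultimately show False using Q by (auto simp: \<Q>_def)
  qed
  \<comment> \<open>The coefficient \<open>c y\<close> depends on a choice, but by
    \<open>colon\<close> two choices differ by an element of \<open>p\<close>, which kills
    \<open>u\<close>. Hence \<open>y \<mapsto> c y u\<close> is the candidate for the
    homomorphism.\<close>
  define c where "c y = (SOME a. a \<in> carrier R \<and> (\<exists>q\<in>Q. s \<odot>\<^bsub>X\<^esub> y = a \<odot>\<^bsub>X\<^esub> x1 \<oplus>\<^bsub>X\<^esub> q))" for y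
  have c: "c y \<in> carrier R \<and> (\<exists>q\<in>Q. s \<odot>\<^bsub>X\<^esub> y = c y \<odot>\<^bsub>X\<^esub> x1 \<oplus>\<^bsub>X\<^esub> q)" if "y \<in> carrier X" for y
    unfolding c_def by (rule someI_ex) (use s_gen[OF that] in blast)
  have c_eq: "c y \<odot>\<^bsub>M\<^esub> u = a \<odot>\<^bsub>M\<^esub> u"
    if y: "y \<in> carrier X" and a: "a \<in> carrier R" and q: "q \<in> Q" "s \<odot>\<^bsub>X\<^esub> y = a \<odot>\<^bsub>X\<^esub> x1 \<oplus>\<^bsub>X\<^esub> q" for y a q
  proof -
    obtain q' where q': "q' \<in> Q" "s \<odot>\<^bsub>X\<^esub> y = c y \<odot>\<^bsub>X\<^esub> x1 \<oplus>\<^bsub>X\<^esub> q'" and cR: "c y \<in> carrier R"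
      using c[OF y] by blast
    have "c y \<odot>\<^bsub>X\<^esub> x1 \<ominus>\<^bsub>X\<^esub> a \<odot>\<^bsub>X\<^esub> x1 = q \<ominus>\<^bsub>X\<^esub> q'"
      using q(2) q'(2) cR a x1(1) QX[OF q(1)] QX[OF q'(1)] by (intro X.M.minus_eq_minus_swap) auto
    then have "(c y \<ominus>\<^bsub>R\<^esub> a) \<odot>\<^bsub>X\<^esub> x1 = q \<ominus>\<^bsub>X\<^esub> q'"
      using cR a x1(1) by (simp add: X.R.minus_eq X.M.minus_eq X.smult_l_distr X.smult_l_minus)
    then have "(c y \<ominus>\<^bsub>R\<^esub> a) \<odot>\<^bsub>X\<^esub> x1 \<in> Q" using Q.minus_closed[OF q(1) q'(1)] by simp
    then have "c y \<ominus>\<^bsub>R\<^esub> a \<in> p" using cR a by (intro colon) simp_all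
    then have "(c y \<ominus>\<^bsub>R\<^esub> a) \<odot>\<^bsub>M\<^esub> u = \<zero>\<^bsub>M\<^esub>" using u(2) by blast
    then have "c y \<odot>\<^bsub>M\<^esub> u \<ominus>\<^bsub>M\<^esub> a \<odot>\<^bsub>M\<^esub> u = \<zero>\<^bsub>M\<^esub>"
      using cR a u(1) by (simp add: X.R.minus_eq M.M.minus_eq M.smult_l_distr M.smult_l_minus)
    then show ?thesis using cR a u(1) by simp
  qed
  have "(\<lambda>y. c y \<odot>\<^bsub>M\<^esub> u) \<in> module_hom R X M"
    unfolding module_hom_def
  proof (intro CollectI conjI allI impI Pi_I)
    fix y assume "y \<in> carrier X"
    then show "c y \<odot>\<^bsub>M\<^esub> u \<in> carrier M" using c[of y] u(1) by simp
  next
    fix y z assume yz: "y \<in> carrier X \<and> z \<in> carrier X"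
    obtain q q' where q: "q \<in> Q" "s \<odot>\<^bsub>X\<^esub> y = c y \<odot>\<^bsub>X\<^esub> x1 \<oplus>\<^bsub>X\<^esub> q" "c y \<in> carrier R"
      and q': "q' \<in> Q" "s \<odot>\<^bsub>X\<^esub> z = c z \<odot>\<^bsub>X\<^esub> x1 \<oplus>\<^bsub>X\<^esub> q'" "c z \<in> carrier R"
      using c[of y] c[of z] yz by blast
    have "s \<odot>\<^bsub>X\<^esub> (y \<oplus>\<^bsub>X\<^esub> z) = (c y \<oplus>\<^bsub>R\<^esub> c z) \<odot>\<^bsub>X\<^esub> x1 \<oplus>\<^bsub>X\<^esub> (q \<oplus>\<^bsub>X\<^esub> q')"
      using q q' yz s x1(1) QX[OF q(1)] QX[OF q'(1)]
      by (simp add: X.smult_r_distr X.smult_l_distr X.M.a_ac)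
    then have "c (y \<oplus>\<^bsub>X\<^esub> z) \<odot>\<^bsub>M\<^esub> u = (c y \<oplus>\<^bsub>R\<^esub> c z) \<odot>\<^bsub>M\<^esub> u"
      using yz q q' by (intro c_eq[of _ _ "q \<oplus>\<^bsub>X\<^esub> q'"]) auto
    then show "c (y \<oplus>\<^bsub>X\<^esub> z) \<odot>\<^bsub>M\<^esub> u = c y \<odot>\<^bsub>M\<^esub> u \<oplus>\<^bsub>M\<^esub> c z \<odot>\<^bsub>M\<^esub> u"
      using q(3) q'(3) u(1) by (simp add: M.smult_l_distr)
  next
    fix a y assume ay: "a \<in> carrier R \<and> y \<in> carrier X"
    obtain q where q: "q \<in> Q" "s \<odot>\<^bsub>X\<^esub> y = c y \<odot>\<^bsub>X\<^esub> x1 \<oplus>\<^bsub>X\<^esub> q" "c y \<in> carrier R"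
      using c[of y] ay by blast
    have "s \<odot>\<^bsub>X\<^esub> (a \<odot>\<^bsub>X\<^esub> y) = a \<odot>\<^bsub>X\<^esub> (s \<odot>\<^bsub>X\<^esub> y)"
      using ay s by (simp add: X.smult_assoc_simp X.R.m_comm)
    also have "\<dots> = (a \<otimes>\<^bsub>R\<^esub> c y) \<odot>\<^bsub>X\<^esub> x1 \<oplus>\<^bsub>X\<^esub> a \<odot>\<^bsub>X\<^esub> q"
      using q ay x1(1) QX[OF q(1)] by (simp add: X.smult_r_distr X.smult_assoc1)
    finally have "c (a \<odot>\<^bsub>X\<^esub> y) \<odot>\<^bsub>M\<^esub> u = (a \<otimes>\<^bsub>R\<^esub> c y) \<odot>\<^bsub>M\<^esub> u"
      using ay q by (intro c_eq[of _ _ "a \<odot>\<^bsub>X\<^esub> q"]) auto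
    then show "c (a \<odot>\<^bsub>X\<^esub> y) \<odot>\<^bsub>M\<^esub> u = a \<odot>\<^bsub>M\<^esub> (c y \<odot>\<^bsub>M\<^esub> u)"
      using ay q(3) u(1) by (simp add: M.smult_assoc1)
  qed
  \<comment> \<open>The representation \<open>s x1 = s x1 + 0\<close> gives the value
    \<open>s u\<close>, which is nonzero because \<open>s\<close> is not in
    \<open>p\<close>.\<close>
  moreover have "c x1 \<odot>\<^bsub>M\<^esub> u = s \<odot>\<^bsub>M\<^esub> u"
    using x1(1) s by (intro c_eq[of _ _ "\<zero>\<^bsub>X\<^esub>"]) auto
  then have "c x1 \<odot>\<^bsub>M\<^esub> u \<noteq> \<zero>\<^bsub>M\<^esub>" using s u(2) by auto
  ultimately show ?thesis using x1(1) by (intro bexI[of _ "\<lambda>y. c y \<odot>\<^bsub>M\<^esub> u"] bexI[of _ x1])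
qed

section \<open>Free modules and tensor products\<close>

lemma free_basis_closed:
  assumes "cring R" "s \<in> S"
  shows "free_basis R S s \<in> carrier (free_module R S)"
proof -
  interpret cring R by fact
  show ?thesis
    by (auto simp: free_module_def free_basis_def intro: finite_subset[of _ "{s}"])
qed

text \<open>Every element is a finite combination of basis elements. The induction runs over a
  finite set \<open>A\<close> containing the support, so that clearing the coordinate
  \<open>s\<close> leads to the hypothesis for \<open>A\<close> even when that coordinate was
  already zero.\<close>

lemma free_moduleE:
  assumes "cring R" "submodule R Y (free_module R S)" "\<And>s. s \<in> S \<Longrightarrow> free_basis R S s \<in> Y"
  shows "carrier (free_module R S) \<subseteq> Y"
proof -
  interpret R: cring R by fact
  interpret F: module R "free_module R S" by (rule free_module_is_module) fact
  interpret Y: submodule R Y "free_module R S" by fact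
  have car: "carrier (free_module R S) = {f \<in> S \<rightarrow>\<^sub>E carrier R. finite {s \<in> S. f s \<noteq> \<zero>\<^bsub>R\<^esub>}}"
    by (simp add: free_module_def)
  have "f \<in> Y" if "finite A" "f \<in> S \<rightarrow>\<^sub>E carrier R" "{s \<in> S. f s \<noteq> \<zero>\<^bsub>R\<^esub>} \<subseteq> A" for A f
    using that
  proof (induction A arbitrary: f)
    case empty
    then have "f = \<zero>\<^bsub>free_module R S\<^esub>"
      by (intro ext) (auto simp: free_module_def R.func_space_def PiE_def extensional_def)
    then show ?case by simp
  next
    case (insert s A)
    show ?case
    proof (cases "s \<in> S")
      case True
      define g where "g = f(s := \<zero>\<^bsub>R\<^esub>)"
      have "g \<in> Y" using insert.prems True unfolding g_def
        by (intro insert.IH) (auto simp: PiE_def extensional_def Pi_iff)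
      moreover have fs: "f s \<in> carrier R" using insert.prems True by auto
      then have "f s \<odot>\<^bsub>free_module R S\<^esub> free_basis R S s \<in> Y"
        using assms(3)[OF True] by (rule Y.smult_closed)
      ultimately have "f s \<odot>\<^bsub>free_module R S\<^esub> free_basis R S s \<oplus>\<^bsub>free_module R S\<^esub> g \<in> Y"
        by (intro Y.m_closed)
      moreover have "f s \<odot>\<^bsub>free_module R S\<^esub> free_basis R S s \<oplus>\<^bsub>free_module R S\<^esub> g = f"
      proof (rule ext)
        fix t
        show "(f s \<odot>\<^bsub>free_module R S\<^esub> free_basis R S s \<oplus>\<^bsub>free_module R S\<^esub> g) t = f t"
          using insert.prems(1) True fs PiE_mem[OF insert.prems(1), of t] PiE_arb[OF insert.prems(1), of t]
          by (auto simp: free_module_def R.func_space_def free_basis_def g_def)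
      qed
      ultimately show ?thesis by simp
    next
      case False
      then show ?thesis using insert by (intro insert.IH) auto
    qed
  qed
  then show ?thesis unfolding car by blast
qed

lemma free_module_hom_extend:
  assumes "module R Z" "b \<in> S \<rightarrow> carrier Z"
  shows "\<exists>h \<in> module_hom R (free_module R S) Z. \<forall>s \<in> S. h (free_basis R S s) = b s"
proof -
  interpret Z: module R Z by fact
  interpret F: module R "free_module R S" by (rule free_module_is_module) (rule Z.R.is_cring)
  let ?supp = "\<lambda>f. {s \<in> S. f s \<noteq> \<zero>\<^bsub>R\<^esub>}"
  have car: "carrier (free_module R S) = {f \<in> S \<rightarrow>\<^sub>E carrier R. finite (?supp f)}"
    by (simp add: free_module_def)
  define h where "h f = (\<Oplus>\<^bsub>Z\<^esub>s\<in>?supp f. f s \<odot>\<^bsub>Z\<^esub> b s)" for f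
  \<comment> \<open>The sum may be taken over any finite subset of \<open>S\<close> containing the
    support. Additivity then compares sums over one common index set, the union of both
    supports.\<close>
  have h: "h f = (\<Oplus>\<^bsub>Z\<^esub>s\<in>A. f s \<odot>\<^bsub>Z\<^esub> b s)"
    if "f \<in> carrier (free_module R S)" "finite A" "?supp f \<subseteq> A" "A \<subseteq> S" for f A
    unfolding h_def
  proof (rule Z.add.finprod_mono_neutral_cong_left)
    show "f s \<odot>\<^bsub>Z\<^esub> b s = \<zero>\<^bsub>Z\<^esub>" if "s \<in> A - ?supp f" for s
      using that \<open>A \<subseteq> S\<close> assms(2) by (auto simp: Pi_iff subset_iff)
    show "(\<lambda>s. f s \<odot>\<^bsub>Z\<^esub> b s) \<in> A \<rightarrow> carrier Z"
      using that assms(2) by (auto simp: car PiE_iff Pi_iff subset_iff)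
  qed (use that in auto)
  have "h \<in> module_hom R (free_module R S) Z"
    unfolding module_hom_def
  proof (intro CollectI conjI allI impI Pi_I)
    fix f assume f: "f \<in> carrier (free_module R S)"
    show "h f \<in> carrier Z"
      unfolding h_def using f assms(2) by (intro Z.finsum_closed) (auto simp: car)
  next
    fix f g assume "f \<in> carrier (free_module R S) \<and> g \<in> carrier (free_module R S)"
    then have f: "f \<in> carrier (free_module R S)" and g: "g \<in> carrier (free_module R S)" by auto
    define A where "A = ?supp f \<union> ?supp g"
    have A: "finite A" "A \<subseteq> S" using f g by (auto simp: car A_def)
    have fA: "f s \<in> carrier R" "g s \<in> carrier R" "b s \<in> carrier Z"
      "(f \<oplus>\<^bsub>free_module R S\<^esub> g) s = f s \<oplus>\<^bsub>R\<^esub> g s" if "s \<in> S" for s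
      using f g that assms(2) by (auto simp: car free_module_def Z.R.func_space_def)
    have "h (f \<oplus>\<^bsub>free_module R S\<^esub> g) = (\<Oplus>\<^bsub>Z\<^esub>s\<in>A. (f \<oplus>\<^bsub>free_module R S\<^esub> g) s \<odot>\<^bsub>Z\<^esub> b s)"
      using f g A fA by (intro h) (auto simp: A_def)
    also have "\<dots> = (\<Oplus>\<^bsub>Z\<^esub>s\<in>A. f s \<odot>\<^bsub>Z\<^esub> b s \<oplus>\<^bsub>Z\<^esub> g s \<odot>\<^bsub>Z\<^esub> b s)"
      using A fA by (intro Z.finsum_cong') (auto simp: Z.smult_l_distr subset_iff)
    also have "\<dots> = (\<Oplus>\<^bsub>Z\<^esub>s\<in>A. f s \<odot>\<^bsub>Z\<^esub> b s) \<oplus>\<^bsub>Z\<^esub> (\<Oplus>\<^bsub>Z\<^esub>s\<in>A. g s \<odot>\<^bsub>Z\<^esub> b s)"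
      using A fA by (intro Z.finsum_addf) (auto simp: subset_iff)
    also have "\<dots> = h f \<oplus>\<^bsub>Z\<^esub> h g"
      using h[OF f A(1) _ A(2)] h[OF g A(1) _ A(2)] by (simp add: A_def)
    finally show "h (f \<oplus>\<^bsub>free_module R S\<^esub> g) = h f \<oplus>\<^bsub>Z\<^esub> h g" .
  next
    fix a f assume "a \<in> carrier R \<and> f \<in> carrier (free_module R S)"
    then have f: "f \<in> carrier (free_module R S)" and a: "a \<in> carrier R" by auto
    define A where "A = ?supp f"
    have A: "finite A" "A \<subseteq> S" using f by (auto simp: car A_def)
    have fA: "f s \<in> carrier R" "b s \<in> carrier Z"
      "(a \<odot>\<^bsub>free_module R S\<^esub> f) s = a \<otimes>\<^bsub>R\<^esub> f s" if "s \<in> S" for s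
      using f that assms(2) by (auto simp: car free_module_def Z.R.func_space_def)
    have "h (a \<odot>\<^bsub>free_module R S\<^esub> f) = (\<Oplus>\<^bsub>Z\<^esub>s\<in>A. (a \<odot>\<^bsub>free_module R S\<^esub> f) s \<odot>\<^bsub>Z\<^esub> b s)"
      using a f A fA by (intro h) (auto simp: A_def)
    also have "\<dots> = (\<Oplus>\<^bsub>Z\<^esub>s\<in>A. a \<odot>\<^bsub>Z\<^esub> (f s \<odot>\<^bsub>Z\<^esub> b s))"
      using A a fA by (intro Z.finsum_cong') (auto simp: Z.smult_assoc1 subset_iff)
    also have "\<dots> = a \<odot>\<^bsub>Z\<^esub> h f"
      using A a fA unfolding h_def A_def[symmetric]
      by (intro Z.finsum_smult_ldistr[symmetric]) (auto simp: subset_iff)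
    finally show "h (a \<odot>\<^bsub>free_module R S\<^esub> f) = a \<odot>\<^bsub>Z\<^esub> h f" .
  qed
  moreover have "h (free_basis R S s) = b s" if s: "s \<in> S" for s
  proof -
    have "free_basis R S s \<in> carrier (free_module R S)"
      by (rule free_basis_closed[OF Z.R.is_cring s])
    then have "h (free_basis R S s) = (\<Oplus>\<^bsub>Z\<^esub>t\<in>{s}. free_basis R S s t \<odot>\<^bsub>Z\<^esub> b t)"
      using s by (intro h) (auto simp: free_basis_def)
    also have "\<dots> = b s" using s assms(2) by (auto simp: free_basis_def Pi_iff)
    finally show ?thesis .
  qed
  ultimately show ?thesis by (intro bexI[of _ h] ballI)
qed

section \<open>Tensor products: bilinear maps and annihilators\<close>

lemma tensor_relations_closed:
  assumes "module R M" "module R X"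
  shows "tensor_relations R M X \<subseteq> carrier (free_module R (carrier M \<times> carrier X))"
proof -
  interpret M: module R M + X: module R X using assms .
  interpret F: module R "free_module R (carrier M \<times> carrier X)"
    by (rule free_module_is_module) (rule M.R.is_cring)
  show ?thesis
    unfolding tensor_relations_def Let_def
    by (auto intro!: F.M.minus_closed F.M.a_closed F.smult_closed free_basis_closed M.R.is_cring)
qed

lemma tensor_product_is_module:
  assumes "module R M" "module R X"
  shows "module R (tensor_product R M X)"
proof -
  interpret M: module R M + X: module R X using assms .
  let ?F = "free_module R (carrier M \<times> carrier X)"
  interpret F: module R ?F by (rule free_module_is_module) (rule M.R.is_cring)
  show ?thesis
    unfolding tensor_product_def Let_def
    by (intro quotient_module_is_module(1) F.module_axioms F.span_is_submodule
        tensor_relations_closed assms)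
qed

text \<open>The linear extension of \<open>b\<close> to the free module kills the bilinearity
  relations and so factors through the quotient. Of the resulting map only the fact that its image
  contains the values of \<open>b\<close> is recorded, which is enough to find a nonzero
  value.\<close>

lemma tensor_product_hom:
  assumes "module R M" "module R X" "module R Z"
    and b: "\<And>m x. m \<in> carrier M \<Longrightarrow> x \<in> carrier X \<Longrightarrow> b m x \<in> carrier Z"
    and "\<And>m m' x. m \<in> carrier M \<Longrightarrow> m' \<in> carrier M \<Longrightarrow> x \<in> carrier X \<Longrightarrow>
      b (m \<oplus>\<^bsub>M\<^esub> m') x = b m x \<oplus>\<^bsub>Z\<^esub> b m' x"
    and "\<And>m x x'. m \<in> carrier M \<Longrightarrow> x \<in> carrier X \<Longrightarrow> x' \<in> carrier X \<Longrightarrow>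
      b m (x \<oplus>\<^bsub>X\<^esub> x') = b m x \<oplus>\<^bsub>Z\<^esub> b m x'"
    and "\<And>a m x. a \<in> carrier R \<Longrightarrow> m \<in> carrier M \<Longrightarrow> x \<in> carrier X \<Longrightarrow>
      b (a \<odot>\<^bsub>M\<^esub> m) x = a \<odot>\<^bsub>Z\<^esub> b m x"
    and "\<And>a m x. a \<in> carrier R \<Longrightarrow> m \<in> carrier M \<Longrightarrow> x \<in> carrier X \<Longrightarrow>
      b m (a \<odot>\<^bsub>X\<^esub> x) = a \<odot>\<^bsub>Z\<^esub> b m x"
  shows "\<exists>h \<in> module_hom R (tensor_product R M X) Z.
    \<forall>m \<in> carrier M. \<forall>x \<in> carrier X. b m x \<in> h ` carrier (tensor_product R M X)"
proof -
  interpret M: module R M + X: module R X + Z: module R Z using assms(1-3) .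
  let ?S = "carrier M \<times> carrier X"
  let ?F = "free_module R ?S" and ?e = "free_basis R ?S"
  interpret F: module R ?F by (rule free_module_is_module) (rule M.R.is_cring)
  let ?N = "F.span (tensor_relations R M X)"
  have N: "submodule R ?N ?F"
    by (intro F.span_is_submodule tensor_relations_closed assms(1,2))
  have T: "tensor_product R M X = quotient_module ?F ?N" by (simp add: tensor_product_def Let_def)
  note Q = quotient_module_is_module[OF F.module_axioms N, folded T]
  have "case_prod b \<in> ?S \<rightarrow> carrier Z" using b by auto
  then obtain h where h: "h \<in> module_hom R ?F Z" "\<forall>s\<in>?S. h (?e s) = case_prod b s"
    by (rule bexE[OF free_module_hom_extend[OF assms(3)]])
  interpret h: mod_hom R ?F Z h using h(1) by (intro mod_homI F.module_axioms assms(3))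
  have he: "h (?e (m, x)) = b m x" if "m \<in> carrier M" "x \<in> carrier X" for m x
    using h(2) that by simp
  have ec: "?e (m, x) \<in> carrier ?F" if "m \<in> carrier M" "x \<in> carrier X" for m x
    using that by (intro free_basis_closed M.R.is_cring) simp
  have "tensor_relations R M X \<subseteq> h.ker"
    unfolding tensor_relations_def Let_def h.ker_def
    by (auto simp: he ec b assms(5-8) intro!: F.M.minus_closed)
  then have ker: "?N \<subseteq> h.ker" by (intro F.span_is_subset h.ker_is_submodule)
  let ?p = "\<lambda>x. ?N +>\<^bsub>?F\<^esub> x"
  have surj: "?p ` carrier ?F = carrier (tensor_product R M X)"
    by (auto simp: T quotient_module_def A_RCOSETS_def')
  have "\<exists>g\<in>module_hom R (tensor_product R M X) Z. \<forall>f\<in>carrier ?F. g (?p f) = h f"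
  proof (rule module_hom_factor[OF F.module_axioms Q(1) assms(3) Q(2) surj h(1)])
    fix f assume "f \<in> carrier ?F" "?p f = \<zero>\<^bsub>tensor_product R M X\<^esub>"
    then have "f \<in> a_kernel ?F (tensor_product R M X) ?p" by (simp add: a_kernel_def')
    then show "h f = \<zero>\<^bsub>Z\<^esub>" using Q(3) ker by (auto simp: h.ker_def)
  qed
  then obtain g where g: "g \<in> module_hom R (tensor_product R M X) Z"
    "\<And>f. f \<in> carrier ?F \<Longrightarrow> g (?p f) = h f" by blast
  show ?thesis
  proof (intro bexI[OF _ g(1)] ballI)
    fix m x assume mx: "m \<in> carrier M" "x \<in> carrier X"
    have "?p (?e (m, x)) \<in> carrier (tensor_product R M X)"
      unfolding surj[symmetric] using ec[OF mx] by (rule imageI)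
    moreover have "b m x = g (?p (?e (m, x)))" using mx by (simp add: g(2) ec he)
    ultimately show "b m x \<in> g ` carrier (tensor_product R M X)" by (rule rev_image_eqI)
  qed
qed

text \<open>On generators,
  \<open>a (m \<otimes> x) = (a m) \<otimes> x = 0 \<otimes> x = 0\<close>.\<close>

lemma annihilator_tensor_product:
  assumes "module R M" "module R X"
  shows "annihilator R M \<subseteq> annihilator R (tensor_product R M X)"
proof
  fix a assume a: "a \<in> annihilator R M"
  interpret M: module R M + X: module R X using assms .
  let ?S = "carrier M \<times> carrier X"
  let ?F = "free_module R ?S" and ?e = "free_basis R ?S"
  interpret F: module R ?F by (rule free_module_is_module) (rule M.R.is_cring)
  let ?N = "F.span (tensor_relations R M X)"
  have rel: "tensor_relations R M X \<subseteq> ?N"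
    by (intro F.in_own_span tensor_relations_closed assms)
  have N: "submodule R ?N ?F"
    by (intro F.span_is_submodule tensor_relations_closed assms)
  have T: "tensor_product R M X = quotient_module ?F ?N" by (simp add: tensor_product_def Let_def)
  note Q = quotient_module_is_module[OF F.module_axioms N, folded T]
  have aR: "a \<in> carrier R" using a by (simp add: annihilator_def)
  have ec: "?e (m, x) \<in> carrier ?F" if "m \<in> carrier M" "x \<in> carrier X" for m x
    using that by (intro free_basis_closed M.R.is_cring) simp
  have relN: "?e (c \<odot>\<^bsub>M\<^esub> m, x) \<ominus>\<^bsub>?F\<^esub> (c \<odot>\<^bsub>?F\<^esub> ?e (m, x)) \<in> ?N"
    if "c \<in> carrier R" "m \<in> carrier M" "x \<in> carrier X" for c m x
    using that by (intro subsetD[OF rel]) (auto simp: tensor_relations_def Let_def)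
  \<comment> \<open>The scalar relation for the zero scalar and the zero vector reads
    \<open>e (0, x) - 0 e (0, x)\<close>, that is, \<open>e (0, x)\<close> itself is a
    relation.\<close>
  have 0: "?e (\<zero>\<^bsub>M\<^esub>, x) \<in> ?N" if "x \<in> carrier X" for x
    using relN[of "\<zero>\<^bsub>R\<^esub>" "\<zero>\<^bsub>M\<^esub>" x] ec[of "\<zero>\<^bsub>M\<^esub>" x] that
    by (simp add: F.M.minus_eq F.M.minus_equality[of "\<zero>\<^bsub>?F\<^esub>" "\<zero>\<^bsub>?F\<^esub>"])
  have gen: "a \<odot>\<^bsub>?F\<^esub> ?e (m, x) \<in> ?N" if mx: "m \<in> carrier M" "x \<in> carrier X" for m x
  proof -
    have am: "a \<odot>\<^bsub>M\<^esub> m = \<zero>\<^bsub>M\<^esub>" using a mx by (simp add: annihilator_def)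
    let ?d = "?e (\<zero>\<^bsub>M\<^esub>, x) \<ominus>\<^bsub>?F\<^esub> (a \<odot>\<^bsub>?F\<^esub> ?e (m, x))"
    have d: "?d \<in> ?N" using relN[OF aR mx] am by simp
    have "?e (\<zero>\<^bsub>M\<^esub>, x) \<ominus>\<^bsub>?F\<^esub> ?d \<in> ?N" by (rule submodule.minus_closed[OF N 0[OF mx(2)] d])
    then show ?thesis using ec[of m x] ec[of "\<zero>\<^bsub>M\<^esub>" x] mx aR by (simp add: F.M.minus_minus_cancel)
  qed
  \<comment> \<open>The elements that \<open>a\<close> sends into the span of the relations form a
    submodule containing the basis, so they are all of the free module.\<close>
  let ?Y = "{f \<in> carrier ?F. a \<odot>\<^bsub>?F\<^esub> f \<in> ?N}"
  have "(\<lambda>f. a \<odot>\<^bsub>?F\<^esub> f) \<in> module_hom R ?F ?F"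
    by (rule F.smult_hom[OF aR])
  then have "submodule R ?Y ?F"
    by (rule submodule_vimage[OF F.module_axioms F.module_axioms _ N])
  then have Y: "carrier ?F \<subseteq> ?Y"
    by (rule free_moduleE[OF M.R.is_cring]) (use gen ec in auto)
  have aF: "a \<odot>\<^bsub>?F\<^esub> f \<in> ?N" if "f \<in> carrier ?F" for f using subsetD[OF Y that] by simp
  let ?p = "\<lambda>x. ?N +>\<^bsub>?F\<^esub> x"
  have surj: "?p ` carrier ?F = carrier (tensor_product R M X)"
    by (auto simp: T quotient_module_def A_RCOSETS_def')
  have "a \<odot>\<^bsub>tensor_product R M X\<^esub> ?p f = \<zero>\<^bsub>tensor_product R M X\<^esub>" if f: "f \<in> carrier ?F" for f
  proof -
    have "a \<odot>\<^bsub>?F\<^esub> f \<in> a_kernel ?F (tensor_product R M X) ?p" using aF[OF f] Q(3) by simp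
    then show ?thesis using f aR by (simp add: a_kernel_def' module_hom_smult[OF Q(2)])
  qed
  then show "a \<in> annihilator R (tensor_product R M X)"
    unfolding annihilator_def surj[symmetric] using aR by simp
qed

section \<open>Tensor ideals closed under summands and extensions\<close>

lemma mod_cat_module: "M \<in> mod_cat R \<Longrightarrow> module R M"
  by (simp add: mod_cat_def fg_module_def)

text \<open>The elements of \<open>quotient_module M N\<close> are cosets, not elements of
  \<open>'b\<close>. The universe bound supplies an isomorphic copy \<open>Q\<close> over
  \<open>'b\<close>; the projection composed with the isomorphism still has kernel
  \<open>N\<close>.\<close>

lemma mod_cat_quotient:
  fixes M :: "('a, 'b) module"
  assumes "mod_universe R TYPE('b)" "M \<in> mod_cat R" "submodule R N M"
  obtains Q :: "('a, 'b) module" and p where "Q \<in> mod_cat R" "p \<in> module_hom R M Q"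
    "p ` carrier M = carrier Q" "a_kernel M Q p = N" "module_iso R (quotient_module M N) Q"
proof -
  have M: "module R M" by (rule mod_cat_module[OF assms(2)])
  note P = quotient_module_is_module[OF M assms(3)]
  let ?P = "quotient_module M N" and ?q = "\<lambda>x. N +>\<^bsub>M\<^esub> x"
  have q: "?q ` carrier M = carrier ?P" by (auto simp: quotient_module_def A_RCOSETS_def')
  have "fg_module R ?P"
    by (rule fg_module_image[OF _ P(1,2) q]) (use assms(2) in \<open>simp add: mod_cat_def\<close>)
  then obtain Q :: "('a, 'b) module" where Q: "Q \<in> mod_cat R" "module_iso R ?P Q"
    using mod_universe_fg[OF assms(1)] by blast
  obtain f where f: "f \<in> module_hom R ?P Q" "bij_betw f (carrier ?P) (carrier Q)"
    using Q(2) by (auto simp: module_iso_def)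
  interpret f: mod_hom R ?P Q f by (intro mod_homI P(1) mod_cat_module[OF Q(1)] f(1))
  have qc: "?q x \<in> carrier ?P" if "x \<in> carrier M" for x using imageI[OF that, of ?q] q by simp
  have "(f (?q x) = \<zero>\<^bsub>Q\<^esub>) = (?q x = \<zero>\<^bsub>?P\<^esub>)" if "x \<in> carrier M" for x
    using inj_onD[OF bij_betw_imp_inj_on[OF f(2)], of "?q x" "\<zero>\<^bsub>?P\<^esub>"] qc[OF that] by auto
  then have "a_kernel M Q (\<lambda>x. f (?q x)) = a_kernel M ?P ?q"
    unfolding a_kernel_def' by blast
  then have "a_kernel M Q (\<lambda>x. f (?q x)) = N" using P(3) by simp
  moreover have "(\<lambda>x. f (?q x)) ` carrier M = carrier Q"
    using bij_betw_imp_surj_on[OF f(2)] by (simp add: q image_image[of f ?q, symmetric])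
  ultimately show ?thesis
    using Q module_hom_compose[OF P(2) f(1)] by (intro that)
qed

lemma mod_cat_submodule:
  assumes "noetherian_ring R" "M \<in> mod_cat R" "submodule R N M"
  shows "M\<lparr>carrier := N\<rparr> \<in> mod_cat R"
proof -
  interpret module R M by (rule mod_cat_module[OF assms(2)])
  obtain A where "finite A" "A \<subseteq> carrier M" "span A = carrier M"
    using assms(2) by (auto simp: mod_cat_def fg_module_def)
  then obtain B where "B \<subseteq> N" "finite B" "span B = N"
    using noetherian_submodule[OF assms(1) _ _ assms(3)] submodule.subset[OF assms(3)] by metis
  \<comment> \<open>The span of \<open>B\<close> formed inside the submodule agrees with its span in
    \<open>M\<close>.\<close>
  then show ?thesis
    using submodule_is_module[OF assms(3)] span_li_not_depend(1)[OF _ assms(3), of B]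
    by (auto simp: mod_cat_def fg_module_def)
qed

locale thick_tensor_ideal =
  fixes R :: "('a, 'r) ring_scheme" and \<X> :: "('a, 'b) module set"
  assumes noeth: "noetherian_ring R"
    and univ: "mod_universe R TYPE('b)"
    and subcat: "subcategory R \<X>"
    and tensor: "tensor_ideal R \<X>"
    and summands: "closed_under_direct_summands R \<X>"
    and extensions: "closed_under_extensions R \<X>"
begin

lemma mem_mod_cat: "M \<in> \<X> \<Longrightarrow> M \<in> mod_cat R"
  using subcat by (auto simp: subcategory_def)

section \<open>Membership by extensions and cyclic filtrations\<close>

lemma mem_by_extension:
  assumes "M \<in> mod_cat R" "Q \<in> \<X>" "p \<in> module_hom R M Q" "p ` carrier M = carrier Q"
    and "M\<lparr>carrier := a_kernel M Q p\<rparr> \<in> \<X>"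
  shows "M \<in> \<X>"
proof -
  have "short_exact R (M\<lparr>carrier := a_kernel M Q p\<rparr>) (\<lambda>x. x) M p Q"
    using assms(3,4) by (auto simp: short_exact_def module_hom_def a_kernel_def')
  then show ?thesis using extensions assms unfolding closed_under_extensions_def by blast
qed

text \<open>Adjoining the generators of \<open>N\<close> one at a time gives a filtration whose
  successive quotients are killed by \<open>K\<close> and generated by the image of the new
  generator. Closure under extensions rebuilds \<open>N\<close> from them.\<close>

lemma mem_by_cyclic_filtration:
  assumes cyclic: "\<And>N u. N \<in> mod_cat R \<Longrightarrow> u \<in> carrier N \<Longrightarrow>
      carrier N = (\<lambda>a. a \<odot>\<^bsub>N\<^esub> u) ` carrier R \<Longrightarrow> K \<subseteq> annihilator R N \<Longrightarrow> N \<in> \<X>"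
    and N: "N \<in> mod_cat R" "K \<subseteq> annihilator R N"
  shows "N \<in> \<X>"
proof -
  interpret N: module R N by (rule mod_cat_module[OF N(1)])
  have "N\<lparr>carrier := N.span A\<rparr> \<in> \<X>" if "finite A" "A \<subseteq> carrier N" for A
    using that
  proof (induction A rule: finite_induct)
    case empty
    \<comment> \<open>The filtration starts with the zero module, which counts as cyclic with
      generator zero.\<close>
    have s: "submodule R (N.span {}) N" by (rule N.span_is_submodule) simp
    have "N.span {} = {\<zero>\<^bsub>N\<^esub>}" by (auto simp: N.span_def N.lincomb_def)
    moreover have "(\<lambda>a. a \<odot>\<^bsub>N\<^esub> \<zero>\<^bsub>N\<^esub>) ` carrier R = {\<zero>\<^bsub>N\<^esub>}" by auto
    ultimately show ?case
      using mod_cat_submodule[OF noeth N(1) s] annihilator_submodule[OF s] N(2)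
      by (intro cyclic[of _ "\<zero>\<^bsub>N\<^esub>"]) auto
  next
    case (insert v A)
    let ?M = "N\<lparr>carrier := N.span (insert v A)\<rparr>"
    have v: "v \<in> carrier N" and A: "A \<subseteq> carrier N" using insert.prems by auto
    have sI: "submodule R (N.span (insert v A)) N" by (rule N.span_is_submodule[OF insert.prems])
    have sA: "submodule R (N.span A) N" by (rule N.span_is_submodule[OF A])
    have M: "?M \<in> mod_cat R" by (rule mod_cat_submodule[OF noeth N(1) sI])
    have AI: "N.span A \<subseteq> N.span (insert v A)" by (rule N.span_is_monotone) auto
    then have "submodule R (N.span A) ?M"
      using sA mod_cat_module[OF M] by (simp add: submodule_def)
    then obtain Q :: "('a, 'b) module" and p where Q: "Q \<in> mod_cat R"
      and p: "p \<in> module_hom R ?M Q" "p ` carrier ?M = carrier Q" "a_kernel ?M Q p = N.span A"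
      using mod_cat_quotient[OF univ M] by metis
    interpret p: mod_hom R ?M Q p by (intro mod_homI mod_cat_module M Q p(1))
    have vI: "v \<in> N.span (insert v A)" using N.in_own_span[OF insert.prems] by auto
    have ker: "p y = \<zero>\<^bsub>Q\<^esub>" if "y \<in> N.span A" for y
      using that p(3) by (auto simp: a_kernel_def')
    have "K \<subseteq> annihilator R ?M" using N(2) annihilator_submodule[OF sI] by (rule subset_trans)
    also have "\<dots> \<subseteq> annihilator R Q"
      by (rule annihilator_image[OF mod_cat_module[OF M] mod_cat_module[OF Q] p(1,2)])
    finally have K: "K \<subseteq> annihilator R Q" .
    have pv: "p v \<in> carrier Q" using vI p.f_im[of v] by simp
    have "carrier Q \<subseteq> (\<lambda>a. a \<odot>\<^bsub>Q\<^esub> p v) ` carrier R"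
    proof
      fix q assume "q \<in> carrier Q"
      then obtain x where x: "x \<in> N.span (insert v A)" "q = p x" using p(2) by auto
      then obtain a y where a: "a \<in> carrier R" "y \<in> N.span A" "x = a \<odot>\<^bsub>N\<^esub> v \<oplus>\<^bsub>N\<^esub> y"
        using N.span_insertE[OF x(1) v A] by blast
      have "y \<in> carrier ?M" using a(2) AI by auto
      then have "q = a \<odot>\<^bsub>Q\<^esub> p v \<oplus>\<^bsub>Q\<^esub> p y"
        using p.f_add[of "a \<odot>\<^bsub>N\<^esub> v" y] p.f_smult[of a v] submodule.smult_closed[OF sI a(1) vI] vI a x(2)
        by simp
      then show "q \<in> (\<lambda>a. a \<odot>\<^bsub>Q\<^esub> p v) ` carrier R"
        using a pv by (intro image_eqI[of _ _ a]) (simp_all add: ker)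
    qed
    moreover have "(\<lambda>a. a \<odot>\<^bsub>Q\<^esub> p v) ` carrier R \<subseteq> carrier Q" using pv by auto
    ultimately have "Q \<in> \<X>" by (intro cyclic[OF Q pv _ K] equalityI)
    moreover have "?M\<lparr>carrier := a_kernel ?M Q p\<rparr> \<in> \<X>" using insert.IH[OF A] p(3) by simp
    ultimately show ?case by (intro mem_by_extension[OF M _ p(1,2)])
  qed
  moreover obtain A where A: "finite A" "A \<subseteq> carrier N" "N.span A = carrier N"
    using N(1) by (auto simp: mod_cat_def fg_module_def)
  ultimately have "N\<lparr>carrier := carrier N\<rparr> \<in> \<X>" by metis
  then show ?thesis by simp
qed

text \<open>The element \<open>X\<close> is needed because \<open>\<X>\<close> may be empty.\<close>

lemma zero_module_mem:
  assumes "X \<in> \<X>" "N \<in> mod_cat R" "carrier N = {\<zero>\<^bsub>N\<^esub>}"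
  shows "N \<in> \<X>"
proof -
  interpret X: module R X by (rule mod_cat_module[OF mem_mod_cat[OF assms(1)]])
  interpret N: module R N by (rule mod_cat_module[OF assms(2)])
  \<comment> \<open>As \<open>N\<close> is zero, \<open>X\<close> is isomorphic to
    \<open>N \<oplus> X\<close>, which makes \<open>N\<close> a direct summand of
    \<open>X\<close>.\<close>
  have "(\<lambda>x. (\<zero>\<^bsub>N\<^esub>, x)) \<in> module_hom R X (direct_sum N X)"
    by (auto simp: module_hom_def direct_sum_def)
  moreover have "bij_betw (\<lambda>x. (\<zero>\<^bsub>N\<^esub>, x)) (carrier X) (carrier (direct_sum N X))"
    using assms(3) by (auto simp: bij_betw_def inj_on_def direct_sum_def)
  ultimately have "direct_summand R N X"
    using mem_mod_cat[OF assms(1)] by (auto simp: direct_summand_def module_iso_def)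
  then show ?thesis using summands assms unfolding closed_under_direct_summands_def by blast
qed

section \<open>Cyclic modules with prime annihilator\<close>

text \<open>
  \<open>X'\<close> is a copy of \<open>M \<otimes> X\<close>; the homomorphism comes from the bilinear map
  \<open>(a u, y) \<mapsto> a \<phi>(y)\<close>, well defined because \<open>a \<phi>(y) = b (a u)\<close> whenever \<open>\<phi>(y) = b u\<close>.
\<close>

lemma hom_from_annihilated:
  fixes M :: "('a, 'b) module"
  assumes X: "X \<in> \<X>" and M: "M \<in> mod_cat R"
    and u: "u \<in> carrier M" "carrier M = (\<lambda>a. a \<odot>\<^bsub>M\<^esub> u) ` carrier R"
    and \<phi>: "\<phi> \<in> module_hom R X M" "x \<in> carrier X" "\<phi> x \<noteq> \<zero>\<^bsub>M\<^esub>"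
  shows "\<exists>X' \<in> \<X>. annihilator R M \<subseteq> annihilator R X' \<and>
    (\<exists>\<psi> \<in> module_hom R X' M. \<exists>y \<in> carrier X'. \<psi> y \<noteq> \<zero>\<^bsub>M\<^esub>)"
proof -
  let ?T = "tensor_product R M X"
  have mX: "module R X" and mM: "module R M" using mod_cat_module mem_mod_cat X M by blast+
  interpret \<phi>: mod_hom R X M \<phi> by (intro mod_homI mX mM \<phi>(1))
  have T: "module R ?T" by (rule tensor_product_is_module[OF mM mX])
  obtain X' where X': "X' \<in> \<X>" "module_iso R ?T X'"
    using tensor M X unfolding tensor_ideal_def belongs_def by blast
  have mX': "module R X'" by (rule mod_cat_module[OF mem_mod_cat[OF X'(1)]])
  \<comment> \<open>A coefficient of \<open>m\<close> with respect to the generator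
    \<open>u\<close>, determined only modulo the annihilator of \<open>u\<close>.\<close>
  define c where "c m = (SOME a. a \<in> carrier R \<and> m = a \<odot>\<^bsub>M\<^esub> u)" for m
  have ex: "\<exists>a. a \<in> carrier R \<and> m = a \<odot>\<^bsub>M\<^esub> u" if "m \<in> carrier M" for m
    using that u(2) by auto
  have c: "c m \<in> carrier R" "m = c m \<odot>\<^bsub>M\<^esub> u" if "m \<in> carrier M" for m
    using someI_ex[OF ex[OF that]] unfolding c_def by blast+
  have b_eq: "c m \<odot>\<^bsub>M\<^esub> \<phi> y = c (\<phi> y) \<odot>\<^bsub>M\<^esub> m" if "m \<in> carrier M" "y \<in> carrier X" for m y
  proof -
    have y: "\<phi> y \<in> carrier M" using that(2) by simp
    have "c m \<odot>\<^bsub>M\<^esub> \<phi> y = c m \<odot>\<^bsub>M\<^esub> (c (\<phi> y) \<odot>\<^bsub>M\<^esub> u)" using c(2)[OF y] by simp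
    also have "\<dots> = c (\<phi> y) \<odot>\<^bsub>M\<^esub> (c m \<odot>\<^bsub>M\<^esub> u)"
      using c(1)[OF that(1)] c(1)[OF y] u(1) by (simp add: \<phi>.N.smult_left_commute)
    also have "\<dots> = c (\<phi> y) \<odot>\<^bsub>M\<^esub> m" using c(2)[OF that(1)] by simp
    finally show ?thesis .
  qed
  have "\<exists>h \<in> module_hom R ?T M. \<forall>m \<in> carrier M. \<forall>y \<in> carrier X. c m \<odot>\<^bsub>M\<^esub> \<phi> y \<in> h ` carrier ?T"
  proof (rule tensor_product_hom[OF mM mX mM])
    fix m y assume my: "m \<in> carrier M" "y \<in> carrier X"
    show "c m \<odot>\<^bsub>M\<^esub> \<phi> y \<in> carrier M" using c(1) my by simp
    \<comment> \<open>Linearity in \<open>m\<close> is not visible from the chosen coefficient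
      \<open>c m\<close>. By \<open>b_eq\<close> it is traded for \<open>c (\<phi> y)\<close>, which
      stays fixed while \<open>m\<close> varies.\<close>
    show "c (m \<oplus>\<^bsub>M\<^esub> m') \<odot>\<^bsub>M\<^esub> \<phi> y = c m \<odot>\<^bsub>M\<^esub> \<phi> y \<oplus>\<^bsub>M\<^esub> c m' \<odot>\<^bsub>M\<^esub> \<phi> y" if "m' \<in> carrier M" for m'
      using that my c(1)[OF \<phi>.f_im[OF my(2)]] by (simp add: b_eq \<phi>.N.smult_r_distr)
    show "c m \<odot>\<^bsub>M\<^esub> \<phi> (y \<oplus>\<^bsub>X\<^esub> y') = c m \<odot>\<^bsub>M\<^esub> \<phi> y \<oplus>\<^bsub>M\<^esub> c m \<odot>\<^bsub>M\<^esub> \<phi> y'" if "y' \<in> carrier X" for y'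
      using that my c(1)[OF my(1)] by (simp add: \<phi>.N.smult_r_distr)
    show "c (a \<odot>\<^bsub>M\<^esub> m) \<odot>\<^bsub>M\<^esub> \<phi> y = a \<odot>\<^bsub>M\<^esub> (c m \<odot>\<^bsub>M\<^esub> \<phi> y)" if "a \<in> carrier R" for a
      using that my c(1)[OF \<phi>.f_im[OF my(2)]]
      by (simp add: b_eq) (simp add: \<phi>.N.smult_left_commute)
    show "c m \<odot>\<^bsub>M\<^esub> \<phi> (a \<odot>\<^bsub>X\<^esub> y) = a \<odot>\<^bsub>M\<^esub> (c m \<odot>\<^bsub>M\<^esub> \<phi> y)" if "a \<in> carrier R" for a
      using that my c(1)[OF my(1)] by (simp add: \<phi>.N.smult_left_commute)
  qed
  then obtain h where h: "h \<in> module_hom R ?T M" "c u \<odot>\<^bsub>M\<^esub> \<phi> x \<in> h ` carrier ?T"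
    using u(1) \<phi>(2) by blast
  \<comment> \<open>The value of the bilinear map at \<open>(u, x)\<close> is
    \<open>\<phi> x\<close>. The chosen \<open>c u\<close> need not be one, so this is read off from
    \<open>b_eq\<close>.\<close>
  have "c u \<odot>\<^bsub>M\<^esub> \<phi> x = \<phi> x" using b_eq[OF u(1) \<phi>(2)] c(2)[of "\<phi> x"] \<phi>(2) by simp
  then obtain t where t: "t \<in> carrier ?T" "h t = \<phi> x" using h(2) by (metis imageE)
  obtain f where f: "f \<in> module_hom R ?T X'" "bij_betw f (carrier ?T) (carrier X')"
    using X'(2) by (auto simp: module_iso_def)
  obtain g where g: "g \<in> module_hom R X' ?T" "bij_betw g (carrier X') (carrier ?T)"
    using module_iso_sym[OF T X'(2)] by (auto simp: module_iso_def)
  obtain y where y: "y \<in> carrier X'" "g y = t"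
    using t(1) bij_betw_imp_surj_on[OF g(2)] by (metis imageE)
  have "annihilator R M \<subseteq> annihilator R X'"
    using annihilator_tensor_product[OF mM mX]
      annihilator_image[OF T mX' f(1) bij_betw_imp_surj_on[OF f(2)]] by (rule subset_trans)
  moreover have "(\<lambda>y. h (g y)) \<in> module_hom R X' M" by (rule module_hom_compose[OF g(1) h(1)])
  moreover have "h (g y) \<noteq> \<zero>\<^bsub>M\<^esub>" using y(2) t(2) \<phi>(3) by simp
  ultimately show ?thesis
    using X'(1) y(1) by (intro bexI[of _ X'] bexI[of _ "\<lambda>y. h (g y)"] bexI[of _ y] conjI)
qed

text \<open>Here \<open>M\<close> is \<open>R / p\<close> up to isomorphism, and
  \<open>torsion\<close> is the form in which the induction hypothesis is supplied. It is applied to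
  the cokernel \<open>C\<close> in \<open>0 -> X -> M \<oplus> X / R x -> C -> 0\<close>; then the
  middle term and its summand \<open>M\<close> belong to the subcategory.\<close>

lemma prime_cyclic_mem:
  assumes X: "X \<in> \<X>" and M: "M \<in> mod_cat R"
    and u: "u \<in> carrier M" "carrier M = (\<lambda>a. a \<odot>\<^bsub>M\<^esub> u) ` carrier R"
    and p: "primeideal p R" "{a \<in> carrier R. a \<odot>\<^bsub>M\<^esub> u = \<zero>\<^bsub>M\<^esub>} = p" "p \<subseteq> annihilator R X"
    and \<phi>: "\<phi> \<in> module_hom R X M" "x \<in> carrier X" "\<phi> x \<noteq> \<zero>\<^bsub>M\<^esub>"
    and torsion: "\<And>N s. N \<in> mod_cat R \<Longrightarrow> p \<subseteq> annihilator R N \<Longrightarrow> s \<in> annihilator R N \<Longrightarrow>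
      s \<notin> p \<Longrightarrow> N \<in> \<X>"
  shows "M \<in> \<X>"
proof -
  have mX: "module R X" and mM: "module R M" using mod_cat_module mem_mod_cat X M by blast+
  interpret \<phi>: mod_hom R X M \<phi> by (intro mod_homI mX mM \<phi>(1))
  interpret p: primeideal p R by (rule p(1))
  have ex: "\<exists>a \<in> carrier R. m = a \<odot>\<^bsub>M\<^esub> u" if "m \<in> carrier M" for m
    using that u(2) by auto
  obtain s where s: "s \<in> carrier R" "\<phi> x = s \<odot>\<^bsub>M\<^esub> u" using ex[of "\<phi> x"] \<phi>(2) by auto
  have sp: "s \<notin> p" using s \<phi>(3) p(2) by auto
  let ?Y = "(\<lambda>a. a \<odot>\<^bsub>X\<^esub> x) ` carrier R"
  obtain Q :: "('a, 'b) module" and q where Q: "Q \<in> mod_cat R"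
    and q: "q \<in> module_hom R X Q" "q ` carrier X = carrier Q" "a_kernel X Q q = ?Y"
    using mod_cat_quotient[OF univ mem_mod_cat[OF X] \<phi>.M.cyclic_submodule[OF \<phi>(2)]] by metis
  have mQ: "module R Q" by (rule mod_cat_module[OF Q])
  interpret q: mod_hom R X Q q by (intro mod_homI mX mQ q(1))
  let ?D = "direct_sum M Q"
  interpret D: module R ?D by (rule direct_sum_is_module[OF mM mQ])
  have "fg_module R ?D" using M Q by (intro fg_module_direct_sum) (auto simp: mod_cat_def)
  \<comment> \<open>\<open>P\<close> is a copy of \<open>M \<oplus> Q\<close> over the type
    \<open>'b\<close>, and the embedding \<open>\<psi>\<close> of \<open>X\<close> below takes its
    values there.\<close>
  then obtain P :: "('a, 'b) module" where P: "P \<in> mod_cat R" "module_iso R ?D P"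
    using mod_universe_fg[OF univ] by blast
  have mP: "module R P" by (rule mod_cat_module[OF P(1)])
  obtain f where f: "f \<in> module_hom R ?D P" "bij_betw f (carrier ?D) (carrier P)"
    using P(2) by (auto simp: module_iso_def)
  interpret f: mod_hom R ?D P f by (intro mod_homI D.module_axioms mP f(1))
  have carD: "carrier ?D = carrier M \<times> carrier Q" by (simp add: direct_sum_def)
  define d where "d y = (\<phi> y, q y)" for y
  have d: "d \<in> module_hom R X ?D"
    by (auto simp: d_def module_hom_def direct_sum_def)
  define \<psi> where "\<psi> y = f (d y)" for y
  have \<psi>: "\<psi> \<in> module_hom R X P" unfolding \<psi>_def by (rule module_hom_compose[OF d f(1)])
  interpret \<psi>: mod_hom R X P \<psi> by (intro mod_homI mX mP \<psi>)
  \<comment> \<open>If \<open>y\<close> and \<open>z\<close> have the same image, then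
    \<open>y - z = a x\<close> with \<open>a s u = 0\<close>. Hence \<open>a s\<close> lies in
    \<open>p\<close>, and so does \<open>a\<close> because \<open>s\<close> does not; finally
    \<open>p\<close> kills \<open>X\<close>.\<close>
  have inj: "inj_on \<psi> (carrier X)"
  proof (rule inj_onI)
    fix y z assume yz: "y \<in> carrier X" "z \<in> carrier X" "\<psi> y = \<psi> z"
    have "d y = d z"
      using yz by (intro inj_onD[OF bij_betw_imp_inj_on[OF f(2)]]) (auto simp: \<psi>_def d_def carD)
    then have "\<phi> y = \<phi> z" "q y = q z" by (auto simp: d_def)
    then have 0: "\<phi> (y \<ominus>\<^bsub>X\<^esub> z) = \<zero>\<^bsub>M\<^esub>" "q (y \<ominus>\<^bsub>X\<^esub> z) = \<zero>\<^bsub>Q\<^esub>" using yz by simp_all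
    then have "y \<ominus>\<^bsub>X\<^esub> z \<in> a_kernel X Q q" using yz by (simp add: a_kernel_def')
    then obtain a where a: "a \<in> carrier R" "y \<ominus>\<^bsub>X\<^esub> z = a \<odot>\<^bsub>X\<^esub> x" unfolding q(3) by (elim imageE)
    have "(a \<otimes>\<^bsub>R\<^esub> s) \<odot>\<^bsub>M\<^esub> u = \<phi> (a \<odot>\<^bsub>X\<^esub> x)"
      using a(1) s u(1) \<phi>(2) by (simp add: \<phi>.N.smult_assoc1)
    then have "a \<otimes>\<^bsub>R\<^esub> s \<in> p" using 0(1) a s(1) unfolding p(2)[symmetric] by simp
    then have "a \<in> p" using p.I_prime[OF a(1) s(1)] sp by blast
    then have "a \<odot>\<^bsub>X\<^esub> x = \<zero>\<^bsub>X\<^esub>" using p(3) \<phi>(2) by (auto simp: annihilator_def)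
    then show "y = z" using a(2) yz by simp
  qed
  obtain C :: "('a, 'b) module" and c where C: "C \<in> mod_cat R"
    and c: "c \<in> module_hom R P C" "c ` carrier P = carrier C" "a_kernel P C c = \<psi> ` carrier X"
    using mod_cat_quotient[OF univ P(1) submodule_image[OF mX mP \<psi>]] by metis
  have mC: "module R C" by (rule mod_cat_module[OF C])
  define e where "e y = c (f y)" for y
  have e: "e \<in> module_hom R ?D C" unfolding e_def by (rule module_hom_compose[OF f(1) c(1)])
  have e_surj: "e ` carrier ?D = carrier C"
    unfolding e_def using c(2) bij_betw_imp_surj_on[OF f(2)]
    by (simp add: image_image[of c f, symmetric])
  have e_d: "e (d y) = \<zero>\<^bsub>C\<^esub>" if "y \<in> carrier X" for y
    using imageI[OF that, of \<psi>] unfolding c(3)[symmetric] by (simp add: a_kernel_def' e_def \<psi>_def)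
  have "p \<subseteq> annihilator R M"
  proof
    fix a assume "a \<in> p"
    then have a: "a \<in> carrier R" "a \<odot>\<^bsub>M\<^esub> u = \<zero>\<^bsub>M\<^esub>" using p(2) by blast+
    have "a \<odot>\<^bsub>M\<^esub> m = \<zero>\<^bsub>M\<^esub>" if m: "m \<in> carrier M" for m
    proof -
      obtain b where b: "b \<in> carrier R" "m = b \<odot>\<^bsub>M\<^esub> u" using ex[OF m] by blast
      then have "a \<odot>\<^bsub>M\<^esub> m = b \<odot>\<^bsub>M\<^esub> (a \<odot>\<^bsub>M\<^esub> u)"
        using a(1) u(1) by (simp add: \<phi>.N.smult_left_commute)
      then show ?thesis using a(2) b(1) by simp
    qed
    then show "a \<in> annihilator R M" using a(1) by (simp add: annihilator_def)
  qed
  moreover have "p \<subseteq> annihilator R Q"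
    using p(3) annihilator_image[OF mX mQ q(1,2)] by (rule subset_trans)
  ultimately have "p \<subseteq> annihilator R ?D"
    by (auto simp: annihilator_def direct_sum_def subset_iff)
  then have pC: "p \<subseteq> annihilator R C"
    using annihilator_image[OF D.module_axioms mC e e_surj] by (rule subset_trans)
  have "s \<odot>\<^bsub>C\<^esub> e y = \<zero>\<^bsub>C\<^esub>" if "y \<in> carrier ?D" for y
  proof -
    obtain m k where mk: "y = (m, k)" "m \<in> carrier M" "k \<in> carrier Q" using \<open>y \<in> carrier ?D\<close> carD by auto
    obtain z where z: "z \<in> carrier X" "k = q z" using mk(3) unfolding q(2)[symmetric] by (elim imageE)
    obtain b where b: "b \<in> carrier R" "m = b \<odot>\<^bsub>M\<^esub> u" using ex[OF mk(2)] by blast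
    obtain b' where b': "b' \<in> carrier R" "\<phi> z = b' \<odot>\<^bsub>M\<^esub> u" using ex[of "\<phi> z"] z(1) by auto
    \<comment> \<open>The witness is made so that \<open>d w = s (m, k)\<close>: the multiple of
      \<open>x\<close> vanishes in \<open>Q\<close>, and because \<open>\<phi> x = s u\<close> it
      corrects the first component from \<open>s b' u\<close> to \<open>s b u\<close>.\<close>
    define w where "w = s \<odot>\<^bsub>X\<^esub> z \<oplus>\<^bsub>X\<^esub> (b \<ominus>\<^bsub>R\<^esub> b') \<odot>\<^bsub>X\<^esub> x"
    have w: "w \<in> carrier X" using s(1) z(1) b(1) b'(1) \<phi>(2) by (simp add: w_def)
    have "x \<in> a_kernel X Q q"
      unfolding q(3) using \<phi>(2) by (intro image_eqI[of _ _ "\<one>\<^bsub>R\<^esub>"]) simp_all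
    then have "q x = \<zero>\<^bsub>Q\<^esub>" by (simp add: a_kernel_def')
    then have qw: "q w = s \<odot>\<^bsub>Q\<^esub> k"
      using s(1) z b(1) b'(1) \<phi>(2) by (simp add: w_def)
    have "\<phi> w = s \<odot>\<^bsub>M\<^esub> (b' \<odot>\<^bsub>M\<^esub> u) \<oplus>\<^bsub>M\<^esub> (b \<ominus>\<^bsub>R\<^esub> b') \<odot>\<^bsub>M\<^esub> (s \<odot>\<^bsub>M\<^esub> u)"
      using s z(1) b(1) b' \<phi>(2) by (simp add: w_def)
    then have "\<phi> w = (s \<otimes>\<^bsub>R\<^esub> b' \<oplus>\<^bsub>R\<^esub> (b \<ominus>\<^bsub>R\<^esub> b') \<otimes>\<^bsub>R\<^esub> s) \<odot>\<^bsub>M\<^esub> u"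
      using s(1) b(1) b'(1) u(1) by (simp add: \<phi>.N.smult_l_distr \<phi>.N.smult_assoc1)
    moreover have "s \<otimes>\<^bsub>R\<^esub> b' \<oplus>\<^bsub>R\<^esub> (b \<ominus>\<^bsub>R\<^esub> b') \<otimes>\<^bsub>R\<^esub> s = s \<otimes>\<^bsub>R\<^esub> b"
      using s(1) b(1) b'(1) by algebra
    ultimately have "\<phi> w = s \<odot>\<^bsub>M\<^esub> m" using b s(1) u(1) by (simp add: \<phi>.N.smult_assoc1)
    then have "d w = s \<odot>\<^bsub>?D\<^esub> y" by (simp add: qw d_def mk(1) direct_sum_def)
    then have "s \<odot>\<^bsub>C\<^esub> e y = e (d w)" using that s(1) by (simp add: module_hom_smult[OF e])
    then show ?thesis using e_d[OF w] by simp
  qed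
  then have "s \<in> annihilator R C"
    unfolding annihilator_def e_surj[symmetric] using s(1) by simp
  then have "C \<in> \<X>" using torsion[OF C pC _ sp] by blast
  moreover have "short_exact R X \<psi> P c C"
    using \<psi> c inj by (simp add: short_exact_def)
  ultimately have PX: "P \<in> \<X>"
    using extensions X P(1) unfolding closed_under_extensions_def by blast
  have "direct_summand R M P"
    using Q module_iso_sym[OF D.module_axioms P(2)] by (auto simp: direct_summand_def)
  then show ?thesis using summands PX M unfolding closed_under_direct_summands_def by blast
qed

section \<open>Noetherian induction on the annihilating ideal\<close>

lemma mem_if_annihilator_subset:
  assumes X: "X \<in> \<X>" and "N \<in> mod_cat R" "annihilator R X \<subseteq> annihilator R N"
  shows "N \<in> \<X>"
proof -
  interpret noetherian_ring R by (rule noeth)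
  have mX: "module R X" by (rule mod_cat_module[OF mem_mod_cat[OF X]])
  have *: "N \<in> \<X>"
    if "ideal J R" "annihilator R X \<subseteq> J" "N \<in> mod_cat R" "J \<subseteq> annihilator R N" for J N
    using that
  proof (induction J arbitrary: N rule: noetherian_ideal_induct)
    case (ideal J)
    note XJ = ideal.prems(1) and N = ideal.prems(2,3)
    \<comment> \<open>An element \<open>s\<close> outside \<open>J\<close> that kills
      \<open>N\<close> makes the annihilator of \<open>N\<close> strictly larger than
      \<open>J\<close>, so the induction hypothesis applies to that annihilator.\<close>
    have torsion: "N \<in> \<X>"
      if "N \<in> mod_cat R" "J \<subseteq> annihilator R N" "s \<in> annihilator R N" "s \<notin> J" for N s
      using ideal.IH[OF annihilator_ideal[OF mod_cat_module[OF that(1)]] _ _ that(1)] that XJ by blast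
    interpret J: ideal J R by (rule ideal.hyps)
    interpret N: module R N by (rule mod_cat_module[OF N(1)])
    show ?case
    proof (cases "primeideal J R")
      case prime: True
      show ?thesis
      proof (rule mem_by_cyclic_filtration[OF _ N])
        fix M :: "('a, 'b) module" and u assume M: "M \<in> mod_cat R" "J \<subseteq> annihilator R M"
          and u: "u \<in> carrier M" "carrier M = (\<lambda>a. a \<odot>\<^bsub>M\<^esub> u) ` carrier R"
        interpret M: module R M by (rule mod_cat_module[OF M(1)])
        let ?I = "{a \<in> carrier R. a \<odot>\<^bsub>M\<^esub> u = \<zero>\<^bsub>M\<^esub>}"
        \<comment> \<open>Since \<open>M\<close> is cyclic over a commutative ring, whatever kills
          its generator kills \<open>M\<close>.\<close>
        have ann: "?I \<subseteq> annihilator R M"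
        proof
          fix a assume a: "a \<in> ?I"
          have "a \<odot>\<^bsub>M\<^esub> (b \<odot>\<^bsub>M\<^esub> u) = b \<odot>\<^bsub>M\<^esub> (a \<odot>\<^bsub>M\<^esub> u)" if "b \<in> carrier R" for b
            using a that u(1) M.smult_left_commute[of a b u] by simp
          then show "a \<in> annihilator R M" using a unfolding annihilator_def u(2) by simp
        qed
        have JI: "J \<subseteq> ?I" using M(2) u(1) by (auto simp: annihilator_def)
        show "M \<in> \<X>"
        proof (cases "?I = J")
          case False
          then obtain s where "s \<in> ?I" "s \<notin> J" using JI by blast
          then show ?thesis using torsion[OF M] ann by blast
        next
          case True
          \<comment> \<open>Now \<open>M\<close> is isomorphic to \<open>R / J\<close>. As
            \<open>X\<close> need not be killed by \<open>J\<close>, the nonzero homomorphism from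
            \<open>X\<close> is first replaced by one from a module \<open>X'\<close> that
            is.\<close>
          have "fg_module R X" using mem_mod_cat[OF X] by (simp add: mod_cat_def)
          then obtain \<phi> x where "\<phi> \<in> module_hom R X M" "x \<in> carrier X" "\<phi> x \<noteq> \<zero>\<^bsub>M\<^esub>"
            using nonzero_hom_to_prime_cyclic[OF _ prime XJ M.module_axioms u(1) True] by blast
          then obtain X' \<psi> y where X': "X' \<in> \<X>" "annihilator R M \<subseteq> annihilator R X'"
            "\<psi> \<in> module_hom R X' M" "y \<in> carrier X'" "\<psi> y \<noteq> \<zero>\<^bsub>M\<^esub>"
            using hom_from_annihilated[OF X M(1) u] by blast
          show ?thesis
          proof (rule prime_cyclic_mem[OF X'(1) M(1) u prime True _ X'(3-5)])
            show "J \<subseteq> annihilator R X'" using M(2) X'(2) by (rule subset_trans)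
          qed (rule torsion)
        qed
      qed
    next
      case False
      show ?thesis
      proof (rule J.primeidealCE[OF N.R.is_cring False])
        \<comment> \<open>The first way to fail to be prime is to be the whole ring; one then kills
          \<open>N\<close>, so \<open>N\<close> is zero.\<close>
        assume RJ: "carrier R = J"
        have "\<one>\<^bsub>R\<^esub> \<in> annihilator R N"
          by (rule subsetD[OF N(2)]) (rule one_closed[unfolded RJ])
        then have "x = \<zero>\<^bsub>N\<^esub>" if "x \<in> carrier N" for x
          using that by (auto simp: annihilator_def)
        then have "carrier N = {\<zero>\<^bsub>N\<^esub>}" by auto
        then show ?thesis by (rule zero_module_mem[OF X N(1)])
      next
        assume "\<exists>a b. a \<in> carrier R \<and> b \<in> carrier R \<and> a \<otimes>\<^bsub>R\<^esub> b \<in> J \<and> a \<notin> J \<and> b \<notin> J"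
        then obtain a b where ab: "a \<in> carrier R" "b \<in> carrier R" "a \<otimes>\<^bsub>R\<^esub> b \<in> J" "a \<notin> J" "b \<notin> J"
          by blast
        \<comment> \<open>The submodule \<open>a N\<close> is killed by \<open>b\<close> and the
          quotient \<open>N / a N\<close> by \<open>a\<close>, while \<open>J\<close> kills both. So
          \<open>torsion\<close> applies to each of them.\<close>
        let ?L = "(\<lambda>x. a \<odot>\<^bsub>N\<^esub> x) ` carrier N"
        have sub: "submodule R ?L N"
          by (rule submodule_image[OF N.module_axioms N.module_axioms N.smult_hom[OF ab(1)]])
        obtain Q :: "('a, 'b) module" and q where Q: "Q \<in> mod_cat R"
          and q: "q \<in> module_hom R N Q" "q ` carrier N = carrier Q" "a_kernel N Q q = ?L"
          using mod_cat_quotient[OF univ N(1) sub] by metis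
        have "b \<odot>\<^bsub>N\<^esub> (a \<odot>\<^bsub>N\<^esub> x) = \<zero>\<^bsub>N\<^esub>" if "x \<in> carrier N" for x
        proof -
          have "b \<odot>\<^bsub>N\<^esub> (a \<odot>\<^bsub>N\<^esub> x) = (a \<otimes>\<^bsub>R\<^esub> b) \<odot>\<^bsub>N\<^esub> x"
            using ab(1,2) that N.smult_left_commute[of b a x] by (simp add: N.smult_assoc1)
          also have "\<dots> = \<zero>\<^bsub>N\<^esub>" using ab(3) N(2) that by (auto simp: annihilator_def)
          finally show ?thesis .
        qed
        then have "b \<in> annihilator R (N\<lparr>carrier := ?L\<rparr>)"
          using ab(2) by (simp add: annihilator_def)
        then have "N\<lparr>carrier := a_kernel N Q q\<rparr> \<in> \<X>"
          unfolding q(3)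
          using mod_cat_submodule[OF noeth N(1) sub] annihilator_submodule[OF sub] N(2) ab(5)
          by (intro torsion[of _ b]) auto
        moreover have "Q \<in> \<X>"
        proof (rule torsion[OF Q _ _ ab(4)])
          show "J \<subseteq> annihilator R Q"
            using N(2) annihilator_image[OF N.module_axioms mod_cat_module[OF Q] q(1,2)]
            by (rule subset_trans)
          have "a \<odot>\<^bsub>Q\<^esub> q x = \<zero>\<^bsub>Q\<^esub>" if "x \<in> carrier N" for x
          proof -
            have "a \<odot>\<^bsub>N\<^esub> x \<in> a_kernel N Q q" unfolding q(3) using that by (rule imageI)
            then show ?thesis
              using that ab(1) by (simp add: a_kernel_def' module_hom_smult[OF q(1)])
          qed
          then show "a \<in> annihilator R Q"
            unfolding annihilator_def q(2)[symmetric] using ab(1) by simp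
        qed
        ultimately show ?thesis by (intro mem_by_extension[OF N(1) _ q(1,2)])
      qed
    qed
  qed
  show ?thesis by (rule *[OF annihilator_ideal[OF mX] subset_refl assms(2,3)])
qed

end

theorem theorem1p1:
  fixes R :: "('a, 'r) ring_scheme" and \<X> :: "('a, 'b) module set"
  assumes "cring R" and "noetherian_ring R"
    and "mod_universe R TYPE('b)"
    and "subcategory R \<X>"
    and "tensor_ideal R \<X>"
    and "closed_under_direct_summands R \<X>"
    and "closed_under_extensions R \<X>"
  shows "serre_subcategory R \<X>"
proof -
  interpret thick_tensor_ideal R \<X> by (rule thick_tensor_ideal.intro) fact+
  \<comment> \<open>Both closure properties reduce to annihilators: whatever kills \<open>M\<close>
    also kills its submodules and quotients.\<close>
  have "closed_under_submodules R \<X>"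
    unfolding closed_under_submodules_def
  proof (intro ballI allI impI)
    fix M N assume M: "M \<in> \<X>" and N: "submodule R N M"
    show "M\<lparr>carrier := N\<rparr> \<in> \<X>"
      using mod_cat_submodule[OF noeth mem_mod_cat[OF M] N] annihilator_submodule[OF N]
      by (rule mem_if_annihilator_subset[OF M])
  qed
  moreover have "closed_under_quotients R \<X>"
    unfolding closed_under_quotients_def
  proof (intro ballI allI impI)
    fix M N assume M: "M \<in> \<X>" and N: "submodule R N M"
    obtain Q :: "('a, 'b) module" and q where Q: "Q \<in> mod_cat R"
      "q \<in> module_hom R M Q" "q ` carrier M = carrier Q" "module_iso R (quotient_module M N) Q"
      using mod_cat_quotient[OF univ mem_mod_cat[OF M] N] by metis
    have "annihilator R M \<subseteq> annihilator R Q"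
      by (rule annihilator_image[OF _ _ Q(2,3)]) (intro mod_cat_module mem_mod_cat M Q(1))+
    then have "Q \<in> \<X>" by (rule mem_if_annihilator_subset[OF M Q(1)])
    with Q(4) show "belongs R (quotient_module M N) \<X>" by (auto simp: belongs_def)
  qed
  ultimately show ?thesis
    using assms(4,7) by (simp add: serre_subcategory_def)
qed

end
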